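(* For all integers $d,h\ge 2$, $$\frac{(d-1)h}{2}-\frac d2\ \le\ \#\mathrm{FRpebbles}(T^h_d)\ \le\ \frac{(d-1)h}{2}+1,$$ and moreover $\#\mathrm{FRpebbles}(T^3_d)=\frac32 d-\frac12$ for all $d\ge 2$, and $\#\mathrm{FRpebbles}(T^4_2)=3$.
   Context: $T^h_d$ is the balanced rooted $d$-ary tree with $h$ levels (height counts levels; $T^2_2$ has 3 nodes). A fractional pebble configuration on a rooted tree assigns to each node $i$ a pair of reals $(b(i),w(i))$ with $b(i),w(i)\ge 0$ and $b(i)+w(i)\le 1$ (black and white pebble values; $b(i)+w(i)$ is the pebble value of $i$); the number of pebbles in the configuration is the sum of all pebble values. Legal moves (always preserving these constraints): (i) decrease $b(i)$ arbitrarily for any node $i$; (ii) increase $w(i)$ arbitrarily for any node $i$; (iii) for any node $i$ all of whose children have pebble value $1$ (vacuous for leaves): decrease $w(i)$ to $0$, increase $b(i)$ arbitrarily, and simultaneously decrease the black values of the children of $i$ arbitrarily. A fractional pebbling using $p$ pebbles is a sequence of legal moves starting and ending with all pebble values $0$, such that at some point the root has black value $1$, and no configuration has more than $p$ pebbles. $\#\mathrm{FRpebbles}(T)$ is the minimum $p$ for which $T$ has a fractional pebbling using $p$ pebbles. *)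

theory Defs
  imports Complex_Main
begin

text \<open>
  A rooted tree is represented by the set of its nodes, where a node is the path leading to it from
  the root: the root is \<open>[]\<close> and \<open>v @ [k]\<close> is the \<open>k\<close>-th child of \<open>v\<close>.
\<close>

type_synonym node = "nat list"

definition is_tree :: "node set \<Rightarrow> bool" where
  "is_tree T \<longleftrightarrow> finite T \<and> [] \<in> T \<and> (\<forall>v k. v @ [k] \<in> T \<longrightarrow> v \<in> T)"

definition children :: "node set \<Rightarrow> node \<Rightarrow> node set" where
  "children T v = {u \<in> T. \<exists>k. u = v @ [k]}"

text \<open>The height \<open>h\<close> counts levels, so paths have length less than \<open>h\<close>.\<close>

definition balanced_tree :: "nat \<Rightarrow> nat \<Rightarrow> node set" where
  "balanced_tree d h = {v. set v \<subseteq> {..<d} \<and> length v < h}"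

lemma is_tree_balanced_tree: "h \<ge> 1 \<Longrightarrow> is_tree (balanced_tree d h)"
proof -
  assume "h \<ge> 1"
  have "balanced_tree d h \<subseteq> {v. set v \<subseteq> {..<d} \<and> length v \<le> h}"
    by (auto simp: balanced_tree_def)
  then have "finite (balanced_tree d h)"
    using finite_lists_length_le[of "{..<d}" h] finite_subset by blast
  with \<open>h \<ge> 1\<close> show ?thesis
    by (auto simp: is_tree_def balanced_tree_def)
qed

lemma children_balanced_tree:
  "v \<in> balanced_tree d h \<Longrightarrow>
    children (balanced_tree d h) v = (if Suc (length v) < h then (\<lambda>k. v @ [k]) ` {..<d} else {})"
  by (auto simp: balanced_tree_def children_def)

text \<open>
  A configuration is a pair \<open>(b, w)\<close> of the black and the white pebble values.
  Only the values at nodes of the tree are relevant.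
\<close>

type_synonym config = "(node \<Rightarrow> real) \<times> (node \<Rightarrow> real)"

definition valid_config :: "node set \<Rightarrow> config \<Rightarrow> bool" where
  "valid_config T = (\<lambda>(b, w). \<forall>v\<in>T. 0 \<le> b v \<and> 0 \<le> w v \<and> b v + w v \<le> 1)"

definition zero_config :: "node set \<Rightarrow> config \<Rightarrow> bool" where
  "zero_config T = (\<lambda>(b, w). \<forall>v\<in>T. b v = 0 \<and> w v = 0)"

definition num_pebbles :: "node set \<Rightarrow> config \<Rightarrow> real" where
  "num_pebbles T = (\<lambda>(b, w). \<Sum>v\<in>T. b v + w v)"

text \<open>
  ``Increase'' and ``decrease'' are non-strict. That moves preserve the constraints on pebble
  values is imposed separately, by requiring all configurations of a pebbling to be valid.
\<close>

inductive legal_move :: "node set \<Rightarrow> config \<Rightarrow> config \<Rightarrow> bool" for T :: "node set" where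
  decrease_black:
    "\<lbrakk>i \<in> T; x \<le> b i\<rbrakk> \<Longrightarrow> legal_move T (b, w) (b(i := x), w)"
| increase_white:
    "\<lbrakk>i \<in> T; w i \<le> x\<rbrakk> \<Longrightarrow> legal_move T (b, w) (b, w(i := x))"
| pebble_node:
    "\<lbrakk>i \<in> T; \<forall>c\<in>children T i. b c + w c = 1;
      b i \<le> b' i; \<forall>c\<in>children T i. b' c \<le> b c;
      \<forall>v. v \<noteq> i \<and> v \<notin> children T i \<longrightarrow> b' v = b v\<rbrakk>
     \<Longrightarrow> legal_move T (b, w) (b', w(i := 0))"

definition fractional_pebbling :: "node set \<Rightarrow> config list \<Rightarrow> bool" where
  "fractional_pebbling T cs \<longleftrightarrow>
     cs \<noteq> [] \<and>
     (\<forall>c\<in>set cs. valid_config T c) \<and>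
     successively (legal_move T) cs \<and>
     zero_config T (hd cs) \<and> zero_config T (last cs) \<and>
     (\<exists>c\<in>set cs. fst c [] = 1)"

definition has_pebbling :: "node set \<Rightarrow> real \<Rightarrow> bool" where
  "has_pebbling T p \<longleftrightarrow>
     (\<exists>cs. fractional_pebbling T cs \<and> (\<forall>c\<in>set cs. num_pebbles T c \<le> p))"

text \<open>
  A genuine minimum over the reals: statements about \<open>FRpebbles\<close> implicitly rely on the
  minimum being attained.
\<close>

definition FRpebbles :: "node set \<Rightarrow> real" where
  "FRpebbles T = (LEAST p. has_pebbling T p)"

end

theory Submission
  imports Defs "HOL-Library.Sublist" "HOL-Library.Infinite_Set"
begin

text \<open>
  The minimum is attained. Between two consecutive moves that pebble the parent of \<open>v\<close>, only the
  first and the last pebbling of \<open>v\<close> are useful. So a pebbling may be assumed to pebble a node of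
  depth \<open>n\<close> at most \<open>2 ^ (n + 1)\<close> times, and pebblings of bounded length are closed under limits.

  Upper bound. To blacken a node, leave half a black pebble on all its children but the last, blacken
  the last one, and complete the others with half a white pebble each. Every further level
  costs \<open>(d - 1) / 2\<close> pebbles.

  Lower bound. In the style of Klawe, a configuration is measured by a weighting \<open>u\<close> of the nodes of
  height at least 2 that, together with the white pebbles, cuts off every black pebble from the leaves;
  the cost of \<open>u\<close> is the maximum over \<open>j\<close> of \<open>(d - 1) j + 2 N\<^sub>j\<close>, where \<open>N\<^sub>j > 0\<close> is the weight of \<open>u\<close> on
  the nodes of height at least \<open>j\<close>. A cheapest \<open>u\<close> can be chosen with no more weight than there are
  pebbles. Hence the cost never exceeds twice the number of pebbles, whereas a black root without any
  white pebbles costs at least \<open>(d - 1) h + 2\<close>.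

  For \<open>h = 3\<close> and for \<open>d = 2, h = 4\<close>, it suffices to look at the last time before and the first time
  after the pebbling of the root at which some parent of leaves is pebbled.
\<close>

text \<open>The level terms of the cost are calibrated at both ends. When a parent of leaves is
  pebbled, its leaves hold \<open>d\<close> pebbles, so the other nodes carry at most
  \<open>p - d\<close>; if \<open>u\<close> weighs no more than that, one new unit of weight at
  height 2 gives \<open>2 (d - 1) + 2 (p - d + 1) = 2 p\<close>. Below a black root without white
  pebbles, if the deepest full node that counts has depth \<open>n\<close>, there are at least
  \<open>(d - 1) n + 1\<close> full nodes, and \<open>(d - 1) (h - n) + 2 ((d - 1) n + 1)\<close> is
  at least \<open>(d - 1) h + 2\<close>. No other kind of move changes \<open>u\<close>: a higher
  node is pebbled when its children have value 1, so they already cut it off. White pebbles may take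
  part in the cut free of charge, since one vanishes only when its node is pebbled, and then the
  children or the new unit of weight take over. The obstacle is that a weighting carried along from
  earlier configurations may outweigh the present pebbles; it must then be exchanged for a lighter
  one within the same budget. Attainment needs more than compactness because the number of pebbles
  does not bound the length of a pebbling.\<close>

section \<open>Pebblings indexed by time\<close>

text \<open>
  All moves other than pebbling \<open>l\<close> are merged into one step. No condition on the new values of \<open>l\<close>
  is needed, since its white value may rise again and its black value may drop in the same step.
\<close>

definition relaxed_step :: "node set \<Rightarrow> node option \<Rightarrow> config \<Rightarrow> config \<Rightarrow> bool" where
  "relaxed_step T l c c' \<longleftrightarrow>
     (\<forall>v\<in>T. l \<noteq> Some v \<longrightarrow> fst c' v \<le> fst c v \<and> snd c v \<le> snd c' v) \<and>
     (\<forall>v. l = Some v \<longrightarrow> v \<in> T \<and> (\<forall>u\<in>children T v. fst c u + snd c u = 1))"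

definition admissible :: "node set \<Rightarrow> real \<Rightarrow> config \<Rightarrow> bool" where
  "admissible T p c \<longleftrightarrow> valid_config T c \<and> num_pebbles T c \<le> p"

definition bounded_step :: "node set \<Rightarrow> real \<Rightarrow> config \<Rightarrow> config \<Rightarrow> bool" where
  "bounded_step T p c c' \<longleftrightarrow> admissible T p c \<and> admissible T p c' \<and> (\<exists>l. relaxed_step T l c c')"

definition legal_within :: "node set \<Rightarrow> real \<Rightarrow> config \<Rightarrow> config \<Rightarrow> bool" where
  "legal_within T p c c' \<longleftrightarrow> admissible T p c \<and> admissible T p c' \<and> legal_move T c c'"

text \<open>Legal moves also fix the values outside the tree, which \<open>relaxed_step\<close>
  leaves free. Setting them to 0 allows sequences of moves to be glued together.\<close>

definition restrict_config :: "node set \<Rightarrow> config \<Rightarrow> config" where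
  "restrict_config T c = (\<lambda>v. if v \<in> T then fst c v else 0, \<lambda>v. if v \<in> T then snd c v else 0)"

lemma valid_config_iff:
  "valid_config T c \<longleftrightarrow> (\<forall>v\<in>T. 0 \<le> fst c v \<and> 0 \<le> snd c v \<and> fst c v + snd c v \<le> 1)"
  by (cases c) (simp add: valid_config_def)

lemma num_pebbles_eq: "num_pebbles T c = (\<Sum>v\<in>T. fst c v + snd c v)"
  by (cases c) (simp add: num_pebbles_def)

lemma zero_config_iff: "zero_config T c \<longleftrightarrow> (\<forall>v\<in>T. fst c v = 0 \<and> snd c v = 0)"
  by (cases c) (simp add: zero_config_def)

lemma admissible_mono:
  assumes "admissible T p c'"
    and "\<And>v. v \<in> T \<Longrightarrow> 0 \<le> fst c v \<and> fst c v \<le> fst c' v \<and> 0 \<le> snd c v \<and> snd c v \<le> snd c' v"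
  shows "admissible T p c"
proof -
  have "num_pebbles T c \<le> num_pebbles T c'"
    unfolding num_pebbles_eq by (rule sum_mono) (use assms(2) in \<open>fastforce intro: add_mono\<close>)
  moreover have "valid_config T c"
    using assms unfolding admissible_def valid_config_iff by (smt (verit))
  ultimately show ?thesis
    using assms(1) by (simp add: admissible_def)
qed

lemma admissible_cong:
  assumes "\<And>v. v \<in> T \<Longrightarrow> fst c v = fst c' v \<and> snd c v = snd c' v"
  shows "admissible T p c \<longleftrightarrow> admissible T p c'"
  using assms by (simp add: admissible_def valid_config_iff num_pebbles_eq cong: sum.cong)

lemma relaxed_step_cong:
  assumes "relaxed_step T l c c'"
    and "\<And>v. v \<in> T \<Longrightarrow> fst c v = fst d v \<and> snd c v = snd d v"
    and "\<And>v. v \<in> T \<Longrightarrow> fst c' v = fst d' v \<and> snd c' v = snd d' v"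
  shows "relaxed_step T l d d'"
proof -
  have "fst d u + snd d u = fst c u + snd c u" if "u \<in> children T v" for u v
    using assms(2)[of u] that by (simp add: children_def)
  note eq = this
  show ?thesis
    unfolding relaxed_step_def
  proof (intro conjI ballI allI impI)
    fix v assume "v \<in> T" "l \<noteq> Some v"
    then show "fst d' v \<le> fst d v" "snd d v \<le> snd d' v"
      using assms by (auto simp: relaxed_step_def)
  next
    fix v assume "l = Some v"
    then show "v \<in> T"
      using assms(1) by (auto simp: relaxed_step_def)
    fix u assume u: "u \<in> children T v"
    show "fst d u + snd d u = 1"
      unfolding eq[OF u] using u assms(1) \<open>l = Some v\<close> by (auto simp: relaxed_step_def)
  qed
qed

lemma legal_move_relaxed_step:
  assumes "legal_move T c c'"
  shows "\<exists>l. relaxed_step T l c c'"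
  using assms
proof cases
  case (decrease_black i x b w)
  then show ?thesis
    by (intro exI[of _ None]) (auto simp: relaxed_step_def)
next
  case (increase_white i w x b)
  then show ?thesis
    by (intro exI[of _ None]) (auto simp: relaxed_step_def)
next
  case (pebble_node i b w b')
  have "b' v \<le> b v" if "v \<noteq> i" for v
    using pebble_node that by (cases "v \<in> children T i") auto
  then show ?thesis
    using pebble_node by (intro exI[of _ "Some i"]) (auto simp: relaxed_step_def)
qed

section \<open>Realising relaxed steps by legal moves\<close>

lemma decrease_blacks:
  assumes "finite S" "S \<subseteq> T" "admissible T p (b, w)"
    and "\<And>v. v \<in> S \<Longrightarrow> 0 \<le> b' v \<and> b' v \<le> b v"
  shows "(legal_within T p)\<^sup>*\<^sup>* (b, w) (\<lambda>v. if v \<in> S then b' v else b v, w)"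
  using assms
proof (induction S rule: finite_induct)
  case empty
  then show ?case by simp
next
  case (insert x S)
  let ?B = "\<lambda>S v. if v \<in> S then b' v else b v"
  have w: "admissible T p (?B S', w)" if "S' \<subseteq> insert x S" for S'
    using insert.prems that
    by (intro admissible_mono[OF insert.prems(2)]) (auto simp: admissible_def valid_config_iff)
  have eq: "?B (insert x S) = (?B S)(x := b' x)"
    by auto
  have "legal_within T p (?B S, w) (?B (insert x S), w)"
    unfolding legal_within_def
  proof (intro conjI)
    show "legal_move T (?B S, w) (?B (insert x S), w)"
      unfolding eq using insert.prems insert.hyps by (intro legal_move.decrease_black) auto
  qed (use w[of S] w[of "insert x S"] in auto)
  with insert show ?case
    by (auto intro: rtranclp.rtrancl_into_rtrancl)
qed

text \<open>White values rise, so admissibility has to be assumed of the final configuration; the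
  intermediate ones lie below it.\<close>

lemma increase_whites:
  assumes "finite S" "S \<subseteq> T" "admissible T p (b, \<lambda>v. if v \<in> S then w' v else w v)"
    and "\<And>v. v \<in> T \<Longrightarrow> 0 \<le> w v" "\<And>v. v \<in> S \<Longrightarrow> w v \<le> w' v"
  shows "(legal_within T p)\<^sup>*\<^sup>* (b, w) (b, \<lambda>v. if v \<in> S then w' v else w v)"
  using assms
proof (induction S rule: finite_induct)
  case empty
  then show ?case by simp
next
  case (insert x S)
  let ?W = "\<lambda>S v. if v \<in> S then w' v else w v"
  have w: "admissible T p (b, ?W S)"
    using insert.prems insert.hyps
    by (intro admissible_mono[OF insert.prems(2)])
      (auto simp: admissible_def valid_config_iff intro: order_trans)
  have eq: "?W (insert x S) = (?W S)(x := w' x)"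
    by auto
  have "legal_within T p (b, ?W S) (b, ?W (insert x S))"
    unfolding legal_within_def
  proof (intro conjI)
    show "legal_move T (b, ?W S) (b, ?W (insert x S))"
      unfolding eq using insert.prems insert.hyps by (intro legal_move.increase_white) auto
  qed (use w insert.prems in auto)
  with insert w show ?case
    by (auto intro: rtranclp.rtrancl_into_rtrancl)
qed

text \<open>A step that pebbles \<open>i\<close> splits into lowering black values away from the
  children of \<open>i\<close>, one pebbling move, and raising white values. The last phase also
  restores whatever white value \<open>i\<close> has after the step.\<close>

lemma bounded_step_legal:
  assumes "finite T" "bounded_step T p c c'"
  shows "(legal_within T p)\<^sup>*\<^sup>* (restrict_config T c) (restrict_config T c')"
proof -
  obtain b w where c: "restrict_config T c = (b, w)" by fastforce
  obtain b' w' where c': "restrict_config T c' = (b', w')" by fastforce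
  have out: "b v = 0" "w v = 0" "b' v = 0" "w' v = 0" if "v \<notin> T" for v
    using c c' that by (auto simp: restrict_config_def)
  obtain l where wc: "admissible T p (b, w)" and wc': "admissible T p (b', w')"
    and l: "relaxed_step T l (b, w) (b', w')"
  proof -
    have c_eq: "\<And>v. v \<in> T \<Longrightarrow> fst c v = fst (b, w) v \<and> snd c v = snd (b, w) v"
      using c by (auto simp: restrict_config_def)
    have c'_eq: "\<And>v. v \<in> T \<Longrightarrow> fst c' v = fst (b', w') v \<and> snd c' v = snd (b', w') v"
      using c' by (auto simp: restrict_config_def)
    obtain l where l: "relaxed_step T l c c'"
      using assms(2) by (auto simp: bounded_step_def)
    have "admissible T p (b, w)" "admissible T p (b', w')"
      using assms(2) admissible_cong[of T c "(b, w)" p] admissible_cong[of T c' "(b', w')" p] c_eq c'_eq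
      by (auto simp: bounded_step_def)
    then show thesis
      using that relaxed_step_cong[OF l c_eq c'_eq] by blast
  qed
  have val: "0 \<le> b v" "0 \<le> w v" "0 \<le> b' v" "0 \<le> w' v" if "v \<in> T" for v
    using wc wc' that by (auto simp: admissible_def valid_config_iff)
  show ?thesis
  proof (cases "\<exists>i. l = Some i")
    case False
    then have mono: "b' v \<le> b v \<and> w v \<le> w' v" if "v \<in> T" for v
      using l that by (simp add: relaxed_step_def)
    have eq: "(\<lambda>v. if v \<in> T then b' v else b v) = b'" "(\<lambda>v. if v \<in> T then w' v else w v) = w'"
      using out by auto
    have "(legal_within T p)\<^sup>*\<^sup>* (b, w) (b', w)"
      using decrease_blacks[OF assms(1) order_refl wc, of b'] mono val by (simp add: eq)
    moreover have "(legal_within T p)\<^sup>*\<^sup>* (b', w) (b', w')"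
      using increase_whites[OF assms(1) order_refl, of p b' w' w] mono val wc' by (simp add: eq)
    ultimately show ?thesis
      by (simp add: c c')
  next
    case True
    then obtain i where i: "i \<in> T" "l = Some i" "\<forall>u\<in>children T i. b u + w u = 1"
      using l by (auto simp: relaxed_step_def)
    then have mono: "b' v \<le> b v \<and> w v \<le> w' v" if "v \<in> T" "v \<noteq> i" for v
      using l that by (auto simp: relaxed_step_def)
    \<comment> \<open>The children of \<open>i\<close> must keep pebble value 1 until the pebbling
      move, which lowers them itself. At \<open>i\<close> the minimum is taken so that the move can
      raise the black value to its target.\<close>
    define S where "S = T - children T i"
    define b1 where "b1 = (\<lambda>v. if v \<in> S then min (b v) (b' v) else b v)"
    have ich: "i \<notin> children T i" and cT: "children T i \<subseteq> T"
      by (auto simp: children_def)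
    have "(legal_within T p)\<^sup>*\<^sup>* (b, w) (b1, w)"
      unfolding b1_def using assms(1) wc val
      by (intro decrease_blacks) (auto simp: S_def)
    moreover have "legal_within T p (b1, w) (b', w(i := 0))"
      unfolding legal_within_def
    proof (intro conjI)
      show "admissible T p (b1, w)"
        by (intro admissible_mono[OF wc]) (use val in \<open>auto simp: b1_def S_def\<close>)
      show "admissible T p (b', w(i := 0))"
        by (intro admissible_mono[OF wc']) (use mono val in auto)
      have "b' v = b1 v" if "v \<noteq> i" "v \<notin> children T i" for v
        using that out mono by (cases "v \<in> T") (auto simp: b1_def S_def)
      then show "legal_move T (b1, w) (b', w(i := 0))"
        using i ich cT mono
        by (intro legal_move.pebble_node) (auto simp: b1_def S_def)
    qed
    moreover have "(legal_within T p)\<^sup>*\<^sup>* (b', w(i := 0)) (b', w')"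
    proof -
      have eq: "(\<lambda>v. if v \<in> T then w' v else (w(i := 0)) v) = w'"
        using out i by auto
      have "0 \<le> (w(i := 0)) v" "(w(i := 0)) v \<le> w' v" if "v \<in> T" for v
        using mono val that by auto
      then show ?thesis
        using increase_whites[OF assms(1) order_refl, of p b' w' "w(i := 0)"] wc'
        unfolding eq by blast
    qed
    ultimately show ?thesis
      by (simp add: c c')
  qed
qed

lemma legal_within_list:
  assumes "(legal_within T p)\<^sup>*\<^sup>* c c'" "admissible T p c"
  shows "\<exists>cs. cs \<noteq> [] \<and> hd cs = c \<and> last cs = c' \<and> successively (legal_move T) cs \<and>
    (\<forall>c\<in>set cs. admissible T p c)"
  using assms(1)
proof induction
  case base
  show ?case
    by (rule exI[of _ "[c]"]) (simp add: assms(2))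
next
  case (step c' c'')
  then obtain cs where "cs \<noteq> []" "hd cs = c" "last cs = c'" "successively (legal_move T) cs"
    "\<forall>c\<in>set cs. admissible T p c"
    by blast
  with step(2) show ?case
    by (intro exI[of _ "cs @ [c'']"])
      (auto simp: legal_within_def successively_append_iff)
qed

lemma has_pebbling_legal:
  assumes "(legal_within T p)\<^sup>*\<^sup>* c\<^sub>0 c" "(legal_within T p)\<^sup>*\<^sup>* c c\<^sub>1" "admissible T p c\<^sub>0"
    and "zero_config T c\<^sub>0" "zero_config T c\<^sub>1" "fst c [] = 1"
  shows "has_pebbling T p"
proof -
  obtain cs where cs: "cs \<noteq> []" "hd cs = c\<^sub>0" "last cs = c" "successively (legal_move T) cs"
    "\<forall>c\<in>set cs. admissible T p c"
    using legal_within_list[OF assms(1,3)] by blast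
  then have "c \<in> set cs"
    by auto
  then have "admissible T p c"
    using cs by blast
  from legal_within_list[OF assms(2) this]
  obtain cs' where cs': "cs' \<noteq> []" "hd cs' = c" "last cs' = c\<^sub>1" "successively (legal_move T) cs'"
    "\<forall>c\<in>set cs'. admissible T p c"
    by blast
  obtain ds where ds: "cs' = c # ds"
    using cs'(1,2) by (cases cs') auto
  have succ: "successively (legal_move T) (cs @ ds)"
    using cs cs' ds by (cases ds) (auto simp: successively_append_iff)
  have "fractional_pebbling T (cs @ ds)"
    unfolding fractional_pebbling_def
  proof (intro conjI)
    show "\<forall>c\<in>set (cs @ ds). valid_config T c"
      using cs(5) cs'(5) ds by (auto simp: admissible_def)
    show "zero_config T (last (cs @ ds))"
      using cs cs' ds assms(5) by (cases ds) auto
    show "\<exists>c\<in>set (cs @ ds). fst c [] = 1"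
      using \<open>c \<in> set cs\<close> assms(6) by auto
  qed (use cs succ assms in auto)
  moreover have "num_pebbles T e \<le> p" if "e \<in> set (cs @ ds)" for e
    using cs(5) cs'(5) ds that by (auto simp: admissible_def)
  ultimately show ?thesis
    unfolding has_pebbling_def by blast
qed

lemma has_pebbling_bounded_steps:
  assumes "finite T" "[] \<in> T"
    and "(bounded_step T p)\<^sup>*\<^sup>* c\<^sub>0 c" "(bounded_step T p)\<^sup>*\<^sup>* c c\<^sub>1" "admissible T p c\<^sub>0"
    and "zero_config T c\<^sub>0" "zero_config T c\<^sub>1" "fst c [] = 1"
  shows "has_pebbling T p"
proof (rule has_pebbling_legal)
  have *: "(legal_within T p)\<^sup>*\<^sup>* (restrict_config T c) (restrict_config T c')"
    if "(bounded_step T p)\<^sup>*\<^sup>* c c'" for c c'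
    using that by induction (auto dest: bounded_step_legal[OF assms(1)])
  show "(legal_within T p)\<^sup>*\<^sup>* (restrict_config T c\<^sub>0) (restrict_config T c)"
    "(legal_within T p)\<^sup>*\<^sup>* (restrict_config T c) (restrict_config T c\<^sub>1)"
    by (intro * assms)+
  show "admissible T p (restrict_config T c\<^sub>0)"
    using assms(5) admissible_cong[of T "restrict_config T c\<^sub>0" c\<^sub>0]
    by (simp add: restrict_config_def)
qed (use assms in \<open>auto simp: restrict_config_def zero_config_iff\<close>)

text \<open>
  A pebbling indexed by time: step \<open>k\<close> pebbles the node \<open>l k\<close>, if any, the root is black at time \<open>m\<close>,
  and everything is over at time \<open>N\<close>.
\<close>

definition schedule ::
  "node set \<Rightarrow> real \<Rightarrow> nat \<Rightarrow> (nat \<Rightarrow> config) \<Rightarrow> (nat \<Rightarrow> node option) \<Rightarrow> nat \<Rightarrow> bool" where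
  "schedule T p N c l m \<longleftrightarrow>
     (\<forall>k. admissible T p (c k) \<and> relaxed_step T (l k) (c k) (c (Suc k))) \<and>
     zero_config T (c 0) \<and> (\<forall>k\<ge>N. zero_config T (c k) \<and> l k = None) \<and>
     m \<le> N \<and> fst (c m) [] = 1"

lemma has_pebbling_schedule:
  assumes "has_pebbling T p"
  shows "\<exists>N c l m. schedule T p N c l m"
proof -
  obtain cs where cs: "fractional_pebbling T cs" "\<And>c. c \<in> set cs \<Longrightarrow> num_pebbles T c \<le> p"
    using assms by (auto simp: has_pebbling_def)
  define N where "N = length cs - 1"
  define c where "c k = cs ! min k N" for k
  have ne: "cs \<noteq> []"
    using cs by (simp add: fractional_pebbling_def)
  then have N: "min k N < length cs" for k
    by (simp add: N_def min_less_iff_disj)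
  have last: "c k = last cs" if "k \<ge> N" for k
    using that ne by (simp add: c_def N_def last_conv_nth)
  have "\<exists>l. relaxed_step T l (c k) (c (Suc k))" if "k < N" for k
  proof -
    have "legal_move T (cs ! k) (cs ! Suc k)"
      using cs(1) that by (auto simp: fractional_pebbling_def N_def successively_conv_nth)
    then show ?thesis
      using that legal_move_relaxed_step by (simp add: c_def min_def)
  qed
  then obtain l where l: "\<And>k. k < N \<Longrightarrow> relaxed_step T (l k) (c k) (c (Suc k))"
    by metis
  define l' where "l' k = (if k < N then l k else None)" for k
  obtain c' where c': "c' \<in> set cs" "fst c' [] = 1"
    using cs(1) by (auto simp: fractional_pebbling_def)
  then obtain m where m: "m < length cs" "cs ! m = c'"
    by (auto simp: in_set_conv_nth)
  have "relaxed_step T (l' k) (c k) (c (Suc k))" for k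
    using l[of k] last[of k] last[of "Suc k"] by (auto simp: l'_def relaxed_step_def)
  moreover have "admissible T p (c k)" for k
    using cs N[of k] by (auto simp: admissible_def c_def fractional_pebbling_def)
  moreover have "c 0 = hd cs"
    using ne by (simp add: c_def hd_conv_nth)
  moreover have "fst (c m) [] = 1"
    using m c' by (auto simp: c_def N_def min_def)
  ultimately have "schedule T p N c l' m"
    using cs(1) m last by (auto simp: schedule_def fractional_pebbling_def l'_def N_def)
  then show ?thesis
    by blast
qed

lemma schedule_has_pebbling:
  assumes "finite T" "[] \<in> T" "schedule T p N c l m"
  shows "has_pebbling T p"
proof -
  have step: "bounded_step T p (c k) (c (Suc k))" for k
    using assms(3) by (auto simp: bounded_step_def schedule_def)
  have steps: "(bounded_step T p)\<^sup>*\<^sup>* (c i) (c j)" if "i \<le> j" for i j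
    using that by (induction rule: dec_induct) (auto intro: rtranclp.rtrancl_into_rtrancl step)
  show ?thesis
    by (rule has_pebbling_bounded_steps[OF assms(1,2) steps[of 0 m] steps[of m N]])
      (use assms(3) in \<open>auto simp: schedule_def\<close>)
qed

lemma scheduleD:
  assumes "schedule T p N c l m"
  shows "admissible T p (c k)" "relaxed_step T (l k) (c k) (c (Suc k))" "zero_config T (c 0)"
    "k \<ge> N \<Longrightarrow> zero_config T (c k)" "k \<ge> N \<Longrightarrow> l k = None" "m \<le> N" "fst (c m) [] = 1"
  using assms by (auto simp: schedule_def)

lemma relaxed_stepD:
  assumes "relaxed_step T l c c'"
  shows "v \<in> T \<Longrightarrow> l \<noteq> Some v \<Longrightarrow> fst c' v \<le> fst c v"
    "v \<in> T \<Longrightarrow> l \<noteq> Some v \<Longrightarrow> snd c v \<le> snd c' v"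
    "l = Some v \<Longrightarrow> v \<in> T"
    "l = Some v \<Longrightarrow> u \<in> children T v \<Longrightarrow> fst c u + snd c u = 1"
  using assms by (auto simp: relaxed_step_def)

section \<open>The minimum is attained\<close>

definition labels :: "(nat \<Rightarrow> node option) \<Rightarrow> node \<Rightarrow> nat set" where
  "labels l v = {k. l k = Some v}"

definition num_labels :: "(nat \<Rightarrow> node option) \<Rightarrow> nat" where
  "num_labels l = card {k. l k \<noteq> None}"

text \<open>The times at which the value of \<open>v\<close> is put to use: when its parent is
  pebbled, and for the root the moment \<open>m\<close> at which it is required to be black.\<close>

definition critical :: "(nat \<Rightarrow> node option) \<Rightarrow> nat \<Rightarrow> node \<Rightarrow> nat set" where
  "critical l m v = (if v = [] then {m} else labels l (butlast v))"

lemma schedule_finite_labels: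
  assumes "schedule T p N c l m"
  shows "{k. l k \<noteq> None} \<subseteq> {..<N}" "finite {k. l k \<noteq> None}" "finite (labels l v)"
proof -
  show *: "{k. l k \<noteq> None} \<subseteq> {..<N}"
    using scheduleD(5)[OF assms] by (force simp: not_le[symmetric])
  then show **: "finite {k. l k \<noteq> None}"
    using finite_subset by blast
  show "finite (labels l v)"
    by (rule finite_subset[OF _ **]) (auto simp: labels_def)
qed

text \<open>
  Only the two pebblings of \<open>v\<close> next to a time at which its parent is pebbled matter: the values of
  \<open>v\<close> can be cleared whenever no such time is reachable without pebbling \<open>v\<close> in between.
\<close>

lemma schedule_remove_labels:
  assumes "schedule T p N c l m" "v \<in> T" "card (labels l v) > 2 * card (critical l m v)"
  shows "\<exists>c' l'. schedule T p N c' l' m \<and> num_labels l' < num_labels l"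
proof -
  note sch = scheduleD[OF assms(1)]
  \<comment> \<open>Step \<open>k\<close> lies between times \<open>k\<close> and
    \<open>k + 1\<close>. The half-open interval therefore lists exactly the steps between
    \<open>s\<close> and the critical time \<open>t\<close>, in either direction.\<close>
  define alive where
    "alive s \<longleftrightarrow> (\<exists>t\<in>critical l m v. \<forall>k. l k = Some v \<longrightarrow> \<not> (min s t \<le> k \<and> k < max s t))" for s
  define c' where "c' s = (if alive s then c s else ((fst (c s))(v := 0), (snd (c s))(v := 0)))" for s
  define l' where "l' k = (if l k = Some v \<and> \<not> alive k \<and> \<not> alive (Suc k) then None else l k)" for k
  have crit: "alive s" if "s \<in> critical l m v" for s
    unfolding alive_def by (rule bexI[OF _ that]) simp
  have same: "fst (c' s) u = fst (c s) u \<and> snd (c' s) u = snd (c s) u" if "u \<noteq> v \<or> alive s" for u s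
    using that by (auto simp: c'_def)
  have dead: "fst (c' s) v = 0 \<and> snd (c' s) v = 0" if "\<not> alive s" for s
    using that by (auto simp: c'_def)
  have alive_Suc: "alive (Suc k) \<longleftrightarrow> alive k" if "l k \<noteq> Some v" for k
  proof -
    have "min (Suc k) t \<le> j \<and> j < max (Suc k) t \<longleftrightarrow> min k t \<le> j \<and> j < max k t" if "l j = Some v" for t j
    proof -
      have "j \<noteq> k"
        using that \<open>l k \<noteq> Some v\<close> by auto
      then show ?thesis
        by auto
    qed
    then show ?thesis
      by (auto simp: alive_def)
  qed
  have nonneg: "0 \<le> fst (c s) u" "0 \<le> snd (c s) u" if "u \<in> T" for s u
    using sch(1)[of s] that by (auto simp: admissible_def valid_config_iff)
  have le: "0 \<le> fst (c' s) u \<and> fst (c' s) u \<le> fst (c s) u \<and> 0 \<le> snd (c' s) u \<and> snd (c' s) u \<le> snd (c s) u"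
    if "u \<in> T" for s u
    using nonneg that by (auto simp: c'_def)
  have "schedule T p N c' l' m"
    unfolding schedule_def
  proof (intro conjI allI impI)
    fix k
    show "admissible T p (c' k)"
      using sch(1) le by (rule admissible_mono)
    show "relaxed_step T (l' k) (c' k) (c' (Suc k))"
      unfolding relaxed_step_def
    proof (intro conjI ballI allI impI)
      fix u assume u: "u \<in> T" "l' k \<noteq> Some u"
      have *: "fst (c' (Suc k)) u \<le> fst (c' k) u \<and> snd (c' k) u \<le> snd (c' (Suc k)) u"
      proof (cases "u = v")
        case True
        show ?thesis
        proof (cases "l k = Some v")
          case True
          then have "\<not> alive k \<and> \<not> alive (Suc k)"
            using u \<open>u = v\<close> by (auto simp: l'_def split: if_splits)
          then show ?thesis
            using dead \<open>u = v\<close> by simp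
        next
          case False
          then show ?thesis
            using alive_Suc[of k] dead[of k] dead[of "Suc k"] same[of v k] same[of v "Suc k"]
              relaxed_stepD(1,2)[OF sch(2)[of k], of v] u \<open>u = v\<close>
            by (cases "alive k") auto
        qed
      next
        case False
        then have "l k \<noteq> Some u"
          using u by (auto simp: l'_def split: if_splits)
        then show ?thesis
          using relaxed_stepD(1,2)[OF sch(2)[of k], of u] u same False by auto
      qed
      then show "fst (c' (Suc k)) u \<le> fst (c' k) u" "snd (c' k) u \<le> snd (c' (Suc k)) u"
        by auto
    next
      fix u assume "l' k = Some u"
      then have l: "l k = Some u"
        by (auto simp: l'_def split: if_splits)
      then show "u \<in> T"
        using relaxed_stepD(3)[OF sch(2)] by blast
      fix x assume x: "x \<in> children T u"
      have "x \<noteq> v \<or> alive k"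
      proof (cases "x = v")
        case True
        then have "v \<noteq> []" "u = butlast v"
          using x by (auto simp: children_def)
        then have "k \<in> critical l m v"
          using l by (simp add: critical_def labels_def)
        then show ?thesis
          using crit by blast
      qed simp
      then show "fst (c' k) x + snd (c' k) x = 1"
        using same relaxed_stepD(4)[OF sch(2) l x] by simp
    qed
  next
    show "zero_config T (c' 0)"
      using sch(3) by (auto simp: c'_def zero_config_iff)
  next
    fix k assume "N \<le> k"
    then show "zero_config T (c' k)" "l' k = None"
      using sch(4,5)[of k] by (auto simp: c'_def l'_def zero_config_iff)
  next
    show "m \<le> N"
      by (rule sch)
    have "v \<noteq> [] \<or> alive m"
      using crit[of m] by (auto simp: critical_def)
    then show "fst (c' m) [] = 1"
      using same[of "[]" m] sch(7) by auto
  qed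
  moreover have "num_labels l' < num_labels l"
  proof -
    define L where "L = labels l v"
    have fin: "finite L" "finite (critical l m v)"
      using schedule_finite_labels[OF assms(1)] by (auto simp: L_def critical_def)
    \<comment> \<open>A surviving pebbling \<open>k\<close> is charged to a critical time
      \<open>t\<close>. If \<open>k\<close> is alive, then \<open>t\<close> precedes it and
      \<open>k\<close> is the first pebbling of \<open>v\<close> from \<open>t\<close> on; if
      \<open>Suc k\<close> is alive, then \<open>k\<close> is the last pebbling of \<open>v\<close>
      before \<open>t\<close>. Each \<open>t\<close> is charged at most twice.\<close>
    have "k \<in> (\<lambda>t. LEAST k. t \<le> k \<and> k \<in> L) ` critical l m v" if kL: "k \<in> L" "alive k" for k
    proof -
      obtain t where t: "t \<in> critical l m v" "\<And>j. j \<in> L \<Longrightarrow> \<not> (min k t \<le> j \<and> j < max k t)"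
        using kL(2) by (auto simp: alive_def L_def labels_def)
      have "t \<le> k"
        using t(2)[OF kL(1)] by auto
      have "(LEAST k. t \<le> k \<and> k \<in> L) = k"
      proof (rule Least_equality)
        show "k \<le> y" if "t \<le> y \<and> y \<in> L" for y
          using t(2)[of y] that \<open>t \<le> k\<close> by (cases "y < k") auto
      qed (use \<open>t \<le> k\<close> kL in auto)
      then show ?thesis
        using t(1) by (intro image_eqI[of _ _ t]) auto
    qed
    moreover have "k \<in> (\<lambda>t. Max {k\<in>L. k < t}) ` critical l m v" if kL: "k \<in> L" "alive (Suc k)" for k
    proof -
      obtain t where t: "t \<in> critical l m v" "\<And>j. j \<in> L \<Longrightarrow> \<not> (min (Suc k) t \<le> j \<and> j < max (Suc k) t)"
        using kL(2) by (auto simp: alive_def L_def labels_def)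
      have "k < t"
        using t(2)[OF kL(1)] by auto
      have "Max {k\<in>L. k < t} = k"
      proof (rule Max_eqI)
        show "y \<le> k" if "y \<in> {k\<in>L. k < t}" for y
          using t(2)[of y] that \<open>k < t\<close> by (cases "k < y") auto
      qed (use \<open>k < t\<close> kL fin in auto)
      then show ?thesis
        using t(1) by (intro image_eqI[of _ _ t]) auto
    qed
    ultimately have "{k\<in>L. alive k \<or> alive (Suc k)} \<subseteq>
        (\<lambda>t. LEAST k. t \<le> k \<and> k \<in> L) ` critical l m v \<union> (\<lambda>t. Max {k\<in>L. k < t}) ` critical l m v"
      by auto
    then have "card {k\<in>L. alive k \<or> alive (Suc k)} \<le>
        card ((\<lambda>t. LEAST k. t \<le> k \<and> k \<in> L) ` critical l m v \<union> (\<lambda>t. Max {k\<in>L. k < t}) ` critical l m v)"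
      using fin by (intro card_mono) auto
    also have "\<dots> \<le> card ((\<lambda>t. LEAST k. t \<le> k \<and> k \<in> L) ` critical l m v)
        + card ((\<lambda>t. Max {k\<in>L. k < t}) ` critical l m v)"
      by (rule card_Un_le)
    also have "\<dots> \<le> 2 * card (critical l m v)"
      unfolding mult_2 by (intro add_mono card_image_le fin)
    finally have "\<not> L \<subseteq> {k\<in>L. alive k \<or> alive (Suc k)}"
      using assms(3) fin card_mono[of "{k\<in>L. alive k \<or> alive (Suc k)}" L] unfolding L_def by auto
    then obtain k where k: "l k = Some v" "\<not> alive k" "\<not> alive (Suc k)"
      by (auto simp: L_def labels_def)
    have "{k. l' k \<noteq> None} \<subset> {k. l k \<noteq> None}"
    proof (rule psubsetI)
      show "{k. l' k \<noteq> None} \<noteq> {k. l k \<noteq> None}"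
        using k by (auto simp: l'_def set_eq_iff)
    qed (auto simp: l'_def)
    then show ?thesis
      unfolding num_labels_def using schedule_finite_labels(2)[OF assms(1)] psubset_card_mono by blast
  qed
  ultimately show ?thesis
    by blast
qed

text \<open>A step without label composes with the step before it. Time \<open>0\<close> must stay
  because the configuration there is zero, and time \<open>m\<close> because the root is black
  there.\<close>

lemma schedule_remove_step:
  assumes "schedule T p N c l m" "0 < k" "k < N" "k \<noteq> m" "l k = None"
  shows "\<exists>c' l' m'. schedule T p (N - 1) c' l' m' \<and> num_labels l' \<le> num_labels l"
proof -
  note sch = scheduleD[OF assms(1)]
  define s where "s j = (if j < k then j else Suc j)" for j
  define c' where "c' = c \<circ> s"
  define l' where "l' = l \<circ> s"
  define m' where "m' = (if m < k then m else m - 1)"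
  have "s m' = m"
    using assms by (auto simp: s_def m'_def)
  have "relaxed_step T (l' j) (c' j) (c' (Suc j))" for j
  proof (cases "Suc j = k")
    case True
    then have *: "c' j = c j" "l' j = l j" "c' (Suc j) = c (Suc (Suc j))"
      by (auto simp: c'_def l'_def s_def)
    have r: "relaxed_step T (l j) (c j) (c (Suc j))" "relaxed_step T None (c (Suc j)) (c (Suc (Suc j)))"
      using sch(2)[of j] sch(2)[of "Suc j"] assms(5) True by auto
    then show ?thesis
      unfolding * relaxed_step_def by (meson option.distinct(1) order_trans)
  next
    case False
    then show ?thesis
      using sch(2)[of "s j"] by (auto simp: c'_def l'_def s_def)
  qed
  moreover have "N \<le> s j" if "N - 1 \<le> j" for j
    using that assms by (auto simp: s_def)
  ultimately have "schedule T p (N - 1) c' l' m'"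
    using sch \<open>s m' = m\<close> assms
    by (auto simp: schedule_def c'_def l'_def s_def m'_def)
  moreover have "num_labels l' \<le> num_labels l"
    unfolding num_labels_def
  proof (rule card_inj_on_le)
    show "inj_on s {k. l' k \<noteq> None}"
      by (auto simp: inj_on_def s_def split: if_splits)
    show "s ` {k. l' k \<noteq> None} \<subseteq> {k. l k \<noteq> None}"
      by (auto simp: l'_def)
  qed (rule schedule_finite_labels(2)[OF assms(1)])
  ultimately show ?thesis
    by blast
qed

text \<open>The bound on the pebblings of a node doubles with each level. The final 2 allows for the
  times \<open>0\<close> and \<open>m\<close>, which are never removed.\<close>

definition max_steps :: "node set \<Rightarrow> nat" where
  "max_steps T = (\<Sum>v\<in>T. 2 ^ Suc (length v)) + 2"

lemma schedule_length_bound: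
  assumes "is_tree T" "schedule T p N c l m"
    and few: "\<And>v. v \<in> T \<Longrightarrow> card (labels l v) \<le> 2 * card (critical l m v)"
    and long: "\<And>k. 0 < k \<Longrightarrow> k < N \<Longrightarrow> k \<noteq> m \<Longrightarrow> l k \<noteq> None"
  shows "N \<le> max_steps T"
proof -
  note sch = scheduleD[OF assms(2)]
  have lab: "card (labels l v) \<le> 2 ^ Suc (length v)" if "v \<in> T" for v
    using that
  proof (induction v rule: rev_induct)
    case Nil
    then show ?case
      using few[of "[]"] by (simp add: critical_def)
  next
    case (snoc k v)
    then have "v \<in> T"
      using assms(1) by (auto simp: is_tree_def)
    then have "card (labels l v) \<le> 2 ^ Suc (length v)"
      by (rule snoc.IH)
    then show ?case
      using few[OF snoc.prems] by (simp add: critical_def)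
  qed
  have "{k. l k \<noteq> None} \<subseteq> (\<Union>v\<in>T. labels l v)"
    using relaxed_stepD(3)[OF sch(2)] by (auto simp: labels_def)
  then have "card {k. l k \<noteq> None} \<le> card (\<Union>v\<in>T. labels l v)"
    using schedule_finite_labels(3)[OF assms(2)] assms(1)
    by (intro card_mono) (auto simp: is_tree_def)
  also have "\<dots> \<le> (\<Sum>v\<in>T. card (labels l v))"
    using assms(1) by (intro card_UN_le) (auto simp: is_tree_def)
  also have "\<dots> \<le> (\<Sum>v\<in>T. 2 ^ Suc (length v))"
    by (intro sum_mono lab)
  finally have "card {k. l k \<noteq> None} \<le> (\<Sum>v\<in>T. 2 ^ Suc (length v))" .
  moreover have "{..<N} \<subseteq> {k. l k \<noteq> None} \<union> {0, m}"
    using long by auto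
  then have "card {..<N} \<le> card ({k. l k \<noteq> None} \<union> {0, m})"
    using schedule_finite_labels(2)[OF assms(2)] by (intro card_mono) auto
  then have "N \<le> card {k. l k \<noteq> None} + card {0, m}"
    using card_Un_le[of "{k. l k \<noteq> None}" "{0, m}"] by simp
  moreover have "card {0, m} \<le> 2"
    by (simp add: card_insert_if)
  ultimately show ?thesis
    by (simp add: max_steps_def)
qed

lemma schedule_mono:
  assumes "schedule T p N c l m" "N \<le> N'"
  shows "schedule T p N' c l m"
proof -
  note sch = scheduleD[OF assms(1)]
  show ?thesis
    unfolding schedule_def
  proof (intro conjI allI impI)
    fix k assume "N' \<le> k"
    then have "N \<le> k"
      using assms(2) by simp
    then show "zero_config T (c k)" "l k = None"
      using sch by auto
  qed (use sch assms(2) in auto)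
qed

lemma schedule_bounded_length:
  assumes "is_tree T" "schedule T p N c l m"
  shows "\<exists>c l m. schedule T p (max_steps T) c l m"
  using assms(2)
proof (induction "N + num_labels l" arbitrary: N c l m rule: less_induct)
  case less
  consider (step) k where "0 < k" "k < N" "k \<noteq> m" "l k = None"
    | (labels) v where "v \<in> T" "card (labels l v) > 2 * card (critical l m v)"
    | (short) "\<And>k. 0 < k \<Longrightarrow> k < N \<Longrightarrow> k \<noteq> m \<Longrightarrow> l k \<noteq> None"
        "\<And>v. v \<in> T \<Longrightarrow> card (labels l v) \<le> 2 * card (critical l m v)"
    by (meson not_le)
  then show ?case
  proof cases
    case step
    from schedule_remove_step[OF less.prems this]
    obtain c' l' m' where s: "schedule T p (N - 1) c' l' m'" "num_labels l' \<le> num_labels l"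
      by (elim exE conjE)
    have "N - 1 + num_labels l' < N + num_labels l"
      using step s(2) by linarith
    then show ?thesis
      by (rule less.hyps[OF _ s(1)])
  next
    case labels
    from schedule_remove_labels[OF less.prems this]
    obtain c' l' where s: "schedule T p N c' l' m" "num_labels l' < num_labels l"
      by (elim exE conjE)
    have "N + num_labels l' < N + num_labels l"
      using s(2) by linarith
    then show ?thesis
      by (rule less.hyps[OF _ s(1)])
  next
    case short
    have "N \<le> max_steps T"
      by (rule schedule_length_bound[OF assms(1) less.prems short(2) short(1)])
    from schedule_mono[OF less.prems this] show ?thesis
      by (intro exI)
  qed
qed

section \<open>Compactness of schedules of bounded length\<close>

lemma convergent_subsequence:
  fixes f :: "nat \<Rightarrow> 'i \<Rightarrow> real"
  assumes "finite A" "\<And>k i. i \<in> A \<Longrightarrow> 0 \<le> f k i \<and> f k i \<le> 1"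
  shows "\<exists>r g. strict_mono r \<and> (\<forall>i\<in>A. (\<lambda>k. f (r k) i) \<longlonglongrightarrow> g i)"
  using assms
proof (induction A rule: finite_induct)
  case empty
  show ?case
    by (rule exI[of _ id]) (simp add: strict_mono_def)
next
  case (insert x A)
  have "\<exists>r g. strict_mono r \<and> (\<forall>i\<in>A. (\<lambda>k. f (r k) i) \<longlonglongrightarrow> g i)"
    by (rule insert.IH) (use insert.prems in simp)
  then obtain r g where r: "strict_mono r" "\<And>i. i \<in> A \<Longrightarrow> (\<lambda>k. f (r k) i) \<longlonglongrightarrow> g i"
    by blast
  obtain s where s: "strict_mono s" "monoseq (\<lambda>k. f (r (s k)) x)"
    using seq_monosub[of "\<lambda>k. f (r k) x"] by auto
  have "Bseq (\<lambda>k. f (r (s k)) x)"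
    using insert.prems by (intro BseqI'[of _ 1]) auto
  then obtain a where a: "(\<lambda>k. f (r (s k)) x) \<longlonglongrightarrow> a"
    using Bseq_monoseq_convergent[OF _ s(2)] by (auto simp: convergent_def)
  have "(\<lambda>k. f ((r \<circ> s) k) i) \<longlonglongrightarrow> (g(x := a)) i" if "i \<in> insert x A" for i
    using that a LIMSEQ_subseq_LIMSEQ[OF r(2) s(1), of i] insert.hyps(2) by (auto simp: o_def)
  then show ?case
    using strict_mono_o[OF r(1) s(1)] by blast
qed

lemma constant_subsequence:
  fixes f :: "nat \<Rightarrow> 'a"
  assumes "finite (range f)"
  shows "\<exists>r a. strict_mono (r :: nat \<Rightarrow> nat) \<and> (\<forall>k. f (r k) = a)"
proof -
  obtain a where "infinite {k. f k = a}"
    using pigeonhole_infinite[of UNIV f] assms by auto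
  then obtain r :: "nat \<Rightarrow> nat" where "strict_mono r" "\<forall>k. r k \<in> {k. f k = a}"
    using infinite_enumerate by blast
  then show ?thesis
    by auto
qed

text \<open>Labels on finitely many steps and the time \<open>m\<close> take finitely many values,
  so they are constant along a subsequence; Bolzano-Weierstrass then handles the pebble values. With
  the labels fixed, the conditions on a schedule are equations and weak inequalities, which survive
  the limit.\<close>

lemma has_pebbling_limit:
  assumes tree: "is_tree T" and peb: "\<And>k. has_pebbling T (q k)" and q: "q \<longlonglongrightarrow> p"
  shows "has_pebbling T p"
proof -
  define N where "N = max_steps T"
  have fin: "finite T" and root: "[] \<in> T"
    using tree by (auto simp: is_tree_def)
  have "\<exists>c l m. schedule T (q k) N c l m" for k
  proof -
    obtain n c l m where "schedule T (q k) n c l m"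
      using has_pebbling_schedule[OF peb[of k]] by blast
    then show ?thesis
      unfolding N_def by (rule schedule_bounded_length[OF tree])
  qed
  then obtain c l m where sch: "\<And>k. schedule T (q k) N (c k) (l k) (m k)"
    by metis
  note sch' = scheduleD[OF sch]
  have lT: "l k j \<in> insert None (Some ` T)" for k j
    using relaxed_stepD(3)[OF sch'(2)[of k j]] by (cases "l k j") auto
  have "set (map (l k) [0..<N]) \<subseteq> insert None (Some ` T)" for k
    using lT[of k] by (simp add: image_subset_iff del: insert_iff)
  then have "range (\<lambda>k. (map (l k) [0..<N], m k)) \<subseteq>
      {xs. set xs \<subseteq> insert None (Some ` T) \<and> length xs = N} \<times> {..N}"
    using sch'(6) by (simp add: image_subset_iff del: insert_iff)
  moreover have "finite ({xs. set xs \<subseteq> insert None (Some ` T) \<and> length xs = N} \<times> {..N})"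
    using fin by (intro finite_cartesian_product finite_lists_length_eq) auto
  ultimately have "finite (range (\<lambda>k. (map (l k) [0..<N], m k)))"
    by (rule finite_subset)
  from constant_subsequence[OF this]
  obtain r :: "nat \<Rightarrow> nat" and a where r: "strict_mono r" and r_eq: "\<forall>k. (map (l (r k)) [0..<N], m (r k)) = a"
    by blast
  note eq = trans[OF spec[OF r_eq] spec[OF r_eq, of 0, symmetric]]
  define L where "L = l (r 0)"
  define M where "M = m (r 0)"
  have m_eq: "m (r k) = M" for k
    using eq[of k] by (simp add: M_def)
  have l_eq: "l (r k) = L" for k
  proof
    fix j
    show "l (r k) j = L j"
    proof (cases "j < N")
      case True
      have "map (l (r k)) [0..<N] = map (l (r 0)) [0..<N]"
        using eq[of k] by simp
      then show ?thesis
        using True by (auto simp: L_def)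
    next
      case False
      then show ?thesis
        using sch'(5) by (simp add: L_def)
    qed
  qed
  \<comment> \<open>All pebble values form one finite vector, indexed by time, node and colour, with
    \<open>True\<close> for black.\<close>
  define f where "f k = (\<lambda>(j, v, x). if x then fst (c (r k) j) v else snd (c (r k) j) v)" for k
  have "0 \<le> f k i \<and> f k i \<le> 1" if "i \<in> {..N} \<times> T \<times> UNIV" for k i
  proof -
    have val: "valid_config T (c (r k) j)" for j
      using sch'(1)[of "r k" j] by (simp add: admissible_def)
    obtain j v x where i: "i = (j, v, x)" "v \<in> T"
      using \<open>i \<in> _\<close> by auto
    show ?thesis
      using bspec[OF val[of j, unfolded valid_config_iff] i(2)] by (cases x) (auto simp: f_def i)
  qed
  then have "\<exists>s g. strict_mono (s :: nat \<Rightarrow> nat) \<and>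
      (\<forall>i\<in>{..N} \<times> T \<times> UNIV. (\<lambda>k. f (s k) i) \<longlonglongrightarrow> g i)"
    using fin by (intro convergent_subsequence) auto
  then obtain s :: "nat \<Rightarrow> nat" and g where s: "strict_mono s"
      "\<And>i. i \<in> {..N} \<times> T \<times> UNIV \<Longrightarrow> (\<lambda>k. f (s k) i) \<longlonglongrightarrow> g i"
    by blast
  define e where "e k = r (s k)" for k
  \<comment> \<open>Times after \<open>N\<close> are frozen at \<open>N\<close>, so that only
    finitely many coordinates have to converge.\<close>
  define C :: "nat \<Rightarrow> config" where
    "C j = (\<lambda>v. g (min j N, v, True), \<lambda>v. g (min j N, v, False))" for j
  have lim: "(\<lambda>k. fst (c (e k) j) v) \<longlonglongrightarrow> fst (C j) v" "(\<lambda>k. snd (c (e k) j) v) \<longlonglongrightarrow> snd (C j) v"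
    if "j \<le> N" "v \<in> T" for j v
    using s(2)[of "(j, v, True)"] s(2)[of "(j, v, False)"] that by (auto simp: f_def C_def e_def min_absorb1)
  have le_lim: "x \<le> y" if "X \<longlonglongrightarrow> x" "Y \<longlonglongrightarrow> y" "\<And>k :: nat. X k \<le> Y k" for X Y :: "nat \<Rightarrow> real" and x y
    using that by (intro LIMSEQ_le[of X x Y y]) auto
  have eq_lim: "x = a" if "X \<longlonglongrightarrow> x" "\<And>k. X k = a" for X :: "nat \<Rightarrow> real" and x a
    using that(1) unfolding that(2) by (rule LIMSEQ_const_iff[THEN iffD1, symmetric])
  have qe: "(\<lambda>k. q (e k)) \<longlonglongrightarrow> p"
    using LIMSEQ_subseq_LIMSEQ[OF q strict_mono_o[OF r s(1)]] by (simp add: o_def e_def)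
  have c_min: "C j = C (min j N)" for j
    by (simp add: C_def)
  have val: "0 \<le> fst (c (e k) j) v" "0 \<le> snd (c (e k) j) v" "fst (c (e k) j) v + snd (c (e k) j) v \<le> 1"
    if "v \<in> T" for k j v
    using sch'(1)[of "e k" j] that by (auto simp: admissible_def valid_config_iff)
  have zero: "zero_config T (C j)" if "j = 0 \<or> j \<ge> N" for j
    unfolding zero_config_iff
  proof
    fix v assume "v \<in> T"
    have "fst (c (e k) (min j N)) v = 0 \<and> snd (c (e k) (min j N)) v = 0" for k
      using sch'(3)[of "e k"] sch'(4)[of N "e k"] that \<open>v \<in> T\<close> by (auto simp: zero_config_iff min_def)
    then show "fst (C j) v = 0 \<and> snd (C j) v = 0"
      using eq_lim[OF lim(1)[of "min j N" v]] eq_lim[OF lim(2)[of "min j N" v]] \<open>v \<in> T\<close>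
      unfolding c_min[of j] by auto
  qed
  have adm: "admissible T p (C j)" if "j \<le> N" for j
    unfolding admissible_def valid_config_iff
  proof (intro conjI ballI)
    fix v assume v: "v \<in> T"
    show "0 \<le> fst (C j) v"
      by (rule le_lim[OF tendsto_const lim(1)[OF that v] val(1)[OF v]])
    show "0 \<le> snd (C j) v"
      by (rule le_lim[OF tendsto_const lim(2)[OF that v] val(2)[OF v]])
    show "fst (C j) v + snd (C j) v \<le> 1"
      by (rule le_lim[OF tendsto_add[OF lim(1)[OF that v] lim(2)[OF that v]] tendsto_const val(3)[OF v]])
  next
    have "(\<lambda>k. num_pebbles T (c (e k) j)) \<longlonglongrightarrow> num_pebbles T (C j)"
      unfolding num_pebbles_eq using lim that by (intro tendsto_sum tendsto_add)
    then show "num_pebbles T (C j) \<le> p"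
      by (rule le_lim[OF _ qe]) (use sch'(1) in \<open>auto simp: admissible_def\<close>)
  qed
  have le_e: "l (e k) = L" "m (e k) = M" for k
    by (simp_all add: e_def l_eq m_eq)
  have "schedule T p N C L M"
    unfolding schedule_def
  proof (intro conjI allI impI)
    fix j
    show "admissible T p (C j)"
      using adm[of "min j N"] c_min[of j] by simp
    show "relaxed_step T (L j) (C j) (C (Suc j))"
    proof (cases "j < N")
      case False
      then have "L j = None" "C (Suc j) = C j"
        using sch'(5)[of j "r 0"] by (auto simp: L_def C_def)
      then show ?thesis
        by (simp add: relaxed_step_def)
    next
      case True
      then have j: "j \<le> N" "Suc j \<le> N"
        by auto
      have step: "relaxed_step T (L j) (c (e k) j) (c (e k) (Suc j))" for k
        using sch'(2)[of "e k" j] by (simp add: le_e)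
      show ?thesis
        unfolding relaxed_step_def
      proof (intro conjI ballI allI impI)
        fix v assume v: "v \<in> T" "L j \<noteq> Some v"
        show "fst (C (Suc j)) v \<le> fst (C j) v"
          by (rule le_lim[OF lim(1)[OF j(2) v(1)] lim(1)[OF j(1) v(1)] relaxed_stepD(1)[OF step v]])
        show "snd (C j) v \<le> snd (C (Suc j)) v"
          by (rule le_lim[OF lim(2)[OF j(1) v(1)] lim(2)[OF j(2) v(1)] relaxed_stepD(2)[OF step v]])
      next
        fix v assume v: "L j = Some v"
        show "v \<in> T"
          using relaxed_stepD(3)[OF step v] .
        fix u assume u: "u \<in> children T v"
        then have "u \<in> T"
          by (simp add: children_def)
        show "fst (C j) u + snd (C j) u = 1"
          by (rule eq_lim[OF tendsto_add[OF lim(1)[OF j(1) \<open>u \<in> T\<close>] lim(2)[OF j(1) \<open>u \<in> T\<close>]]])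
            (rule relaxed_stepD(4)[OF step v u])
      qed
    qed
  next
    show "zero_config T (C 0)"
      by (rule zero) simp
    show "zero_config T (C j)" if "N \<le> j" for j
      using that by (intro zero) simp
    show "L j = None" if "N \<le> j" for j
      using sch'(5)[OF that] by (simp add: L_def)
    show M: "M \<le> N"
      using sch'(6) by (simp add: M_def)
    show "fst (C M) [] = 1"
      by (rule eq_lim[OF lim(1)[OF M root]]) (metis sch'(7) le_e(2))
  qed
  then show ?thesis
    by (rule schedule_has_pebbling[OF fin root])
qed

lemma has_pebbling_nonneg:
  assumes "has_pebbling T p"
  shows "0 \<le> p"
proof -
  obtain N c l m where "schedule T p N c l m"
    using has_pebbling_schedule[OF assms] by blast
  from scheduleD(1)[OF this, of 0] have "valid_config T (c 0)" "num_pebbles T (c 0) \<le> p"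
    by (auto simp: admissible_def)
  moreover from this have "0 \<le> num_pebbles T (c 0)"
    unfolding num_pebbles_eq valid_config_iff by (intro sum_nonneg) simp
  ultimately show ?thesis
    by simp
qed

text \<open>Attainable numbers come arbitrarily close to their infimum, and closedness under limits
  makes the infimum attainable too.\<close>

theorem FRpebbles_minimum:
  assumes "is_tree T" "has_pebbling T q"
  shows "has_pebbling T (FRpebbles T)" "has_pebbling T p \<Longrightarrow> FRpebbles T \<le> p"
proof -
  define S where "S = {p. has_pebbling T p}"
  have bdd: "bdd_below S"
    by (rule bdd_belowI[of _ 0]) (simp add: S_def has_pebbling_nonneg)
  have ne: "S \<noteq> {}"
    using assms(2) by (auto simp: S_def)
  have "\<exists>p. has_pebbling T p \<and> p < Inf S + 1 / real (Suc k)" for k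
    using cInf_lessD[OF ne, of "Inf S + 1 / real (Suc k)"] by (auto simp: S_def)
  then obtain q' where q': "\<And>k. has_pebbling T (q' k)" "\<And>k. q' k < Inf S + 1 / real (Suc k)"
    by metis
  have low: "Inf S \<le> p" if "has_pebbling T p" for p
    using cInf_lower[OF _ bdd, of p] that by (simp add: S_def)
  have "(\<lambda>k. Inf S + 1 / real (Suc k)) \<longlonglongrightarrow> Inf S + 0"
    by (intro tendsto_add tendsto_const LIMSEQ_Suc[OF lim_1_over_n])
  then have "q' \<longlonglongrightarrow> Inf S"
    by (intro tendsto_sandwich[OF _ _ tendsto_const, of "Inf S" q'])
      (use low[OF q'(1)] q'(2) less_imp_le in \<open>auto intro!: always_eventually\<close>)
  then have "has_pebbling T (Inf S)"
    by (rule has_pebbling_limit[OF assms(1) q'(1)])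
  moreover from this have "FRpebbles T = Inf S"
    unfolding FRpebbles_def using low by (intro Least_equality) auto
  ultimately show "has_pebbling T (FRpebbles T)" "has_pebbling T p \<Longrightarrow> FRpebbles T \<le> p"
    using low by auto
qed

section \<open>The upper bound\<close>

lemma admissible_reach:
  assumes "(bounded_step T p)\<^sup>*\<^sup>* c c'" "admissible T p c"
  shows "admissible T p c'"
  using assms by induction (auto simp: bounded_step_def)

lemma num_pebbles_pair: "num_pebbles T (b, w) = sum b T + sum w T"
  by (simp add: num_pebbles_def sum.distrib)

lemma bounded_step_decrease:
  assumes "admissible T p (b, w)"
    and "\<And>x. x \<in> T \<Longrightarrow> 0 \<le> b' x \<and> b' x \<le> b x" "\<And>x. x \<in> T \<Longrightarrow> w' x = w x"
  shows "bounded_step T p (b, w) (b', w')"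
  unfolding bounded_step_def
proof (intro conjI exI)
  show "admissible T p (b', w')"
    by (rule admissible_mono[OF assms(1)])
      (use assms in \<open>auto simp: admissible_def valid_config_iff\<close>)
  show "relaxed_step T None (b, w) (b', w')"
    using assms by (simp add: relaxed_step_def)
qed fact

definition clear_below :: "node set \<Rightarrow> node \<Rightarrow> config \<Rightarrow> bool" where
  "clear_below T v c \<longleftrightarrow> (\<forall>x\<in>T. strict_prefix v x \<longrightarrow> fst c x = 0 \<and> snd c x = 0)"

text \<open>
  A strategy for \<open>v\<close> using \<open>L\<close> pebbles blackens \<open>v\<close> at the price of leaving the white pebbles \<open>f\<close>
  behind below \<open>v\<close>; these can be removed later on, again with \<open>L\<close> pebbles.
\<close>

definition strategy :: "node set \<Rightarrow> real \<Rightarrow> real \<Rightarrow> node \<Rightarrow> (node \<Rightarrow> real) \<Rightarrow> bool" where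
  "strategy T p L v f \<longleftrightarrow>
     (\<forall>x. 0 \<le> f x) \<and> (\<forall>x. \<not> strict_prefix v x \<longrightarrow> f x = 0) \<and> sum f T \<le> L - real (card (children T v)) \<and>
     (\<forall>b w. clear_below T v (b, w) \<and> valid_config T (b, w) \<and> num_pebbles T (b, w) + L \<le> p \<longrightarrow>
       (bounded_step T p)\<^sup>*\<^sup>* (b, w) (b(v := 1), \<lambda>x. (w(v := 0)) x + f x) \<and>
       (bounded_step T p)\<^sup>*\<^sup>* (b, \<lambda>x. w x + f x) (b, w))"

lemma strategyD:
  assumes "strategy T p L v f"
  shows "0 \<le> f x" "\<not> strict_prefix v x \<Longrightarrow> f x = 0" "sum f T \<le> L - real (card (children T v))"
    "clear_below T v (b, w) \<Longrightarrow> valid_config T (b, w) \<Longrightarrow> num_pebbles T (b, w) + L \<le> p \<Longrightarrow>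
      (bounded_step T p)\<^sup>*\<^sup>* (b, w) (b(v := 1), \<lambda>x. (w(v := 0)) x + f x)"
    "clear_below T v (b, w) \<Longrightarrow> valid_config T (b, w) \<Longrightarrow> num_pebbles T (b, w) + L \<le> p \<Longrightarrow>
      (bounded_step T p)\<^sup>*\<^sup>* (b, \<lambda>x. w x + f x) (b, w)"
  using assms by (auto simp: strategy_def)

definition on_children :: "node \<Rightarrow> nat \<Rightarrow> real \<Rightarrow> node \<Rightarrow> real" where
  "on_children v n a x = (if \<exists>j<n. x = v @ [j] then a else 0)"

lemma on_children_simps [simp]:
  "on_children v n a (v @ [j]) = (if j < n then a else 0)"
  "on_children v 0 a x = 0"
  "x \<noteq> v @ [n] \<Longrightarrow> on_children v (Suc n) a x = on_children v n a x"
  by (auto simp: on_children_def less_Suc_eq)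

lemma on_children_eq_0: "\<not> strict_prefix v x \<Longrightarrow> on_children v n a x = 0"
  by (auto simp: on_children_def strict_prefix_def)

lemma on_children_self [simp]: "on_children v n a v = 0"
  by (simp add: on_children_def)

lemma sum_on_children:
  assumes "finite T" "\<And>j. j < n \<Longrightarrow> v @ [j] \<in> T"
  shows "sum (on_children v n a) T = real n * a"
proof -
  have "sum (on_children v n a) T = sum (on_children v n a) ((\<lambda>j. v @ [j]) ` {..<n})"
    using assms by (intro sum.mono_neutral_right) (auto simp: on_children_def)
  also have "\<dots> = (\<Sum>j<n. a)"
    by (subst sum.reindex) (auto simp: inj_on_def)
  finally show ?thesis
    by simp
qed

context
  fixes d h :: nat and T :: "node set" and p :: real and v :: node
  assumes T: "T = balanced_tree d h" and v: "v \<in> T" "Suc (length v) < h" and d: "d \<ge> 2"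
begin

lemma finite_tree: "finite T"
  using is_tree_balanced_tree[of h d] v(2) by (simp add: T is_tree_def)

lemma child_in_tree: "i < d \<Longrightarrow> v @ [i] \<in> T"
  using v by (auto simp: T balanced_tree_def)

lemma children_tree: "children T v = (\<lambda>k. v @ [k]) ` {..<d}"
  using children_balanced_tree[of v d h] v by (simp add: T)

lemma card_children_tree: "card (children T v) = d"
  by (simp add: children_tree card_image inj_on_def)

lemma pebble_children:
  assumes "admissible T p (b, w)" "admissible T p (b', w')"
    and "\<And>i. i < d \<Longrightarrow> b (v @ [i]) + w (v @ [i]) = 1"
    and "\<And>x. x \<in> T \<Longrightarrow> x \<noteq> v \<Longrightarrow> b' x \<le> b x \<and> w x \<le> w' x"
  shows "bounded_step T p (b, w) (b', w')"
  using assms v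
  by (auto simp: bounded_step_def relaxed_step_def children_tree intro!: exI[of _ "Some v"])

lemma strategy_leaves:
  assumes "Suc (Suc (length v)) = h"
  shows "strategy T p (real d) v (\<lambda>x. 0)"
  unfolding strategy_def
proof (intro conjI allI impI)
  fix b w
  assume "clear_below T v (b, w) \<and> valid_config T (b, w) \<and> num_pebbles T (b, w) + real d \<le> p"
  then have clear: "\<And>x. x \<in> T \<Longrightarrow> strict_prefix v x \<Longrightarrow> b x = 0 \<and> w x = 0"
    and valid: "valid_config T (b, w)" and num: "num_pebbles T (b, w) + real d \<le> p"
    by (auto simp: clear_below_def)
  define B where "B n = (\<lambda>x. b x + on_children v n 1 x)" for n
  have adm: "admissible T p (B n, w)" if "n \<le> d" for n
  proof -
    have "sum (on_children v n 1) T = real n"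
      using that child_in_tree by (subst sum_on_children[OF finite_tree]) auto
    then have "num_pebbles T (B n, w) \<le> p"
      using num that by (simp add: num_pebbles_pair B_def sum.distrib)
    moreover have "0 \<le> B n x \<and> 0 \<le> w x \<and> B n x + w x \<le> 1" if "x \<in> T" for x
    proof (cases "\<exists>j<n. x = v @ [j]")
      case True
      then have "strict_prefix v x"
        by (auto simp: strict_prefix_def)
      then show ?thesis
        using True clear[OF that] by (auto simp: B_def)
    next
      case False
      then have "on_children v n 1 x = 0"
        by (auto simp: on_children_def)
      then show ?thesis
        using valid that by (simp add: B_def valid_config_iff)
    qed
    ultimately show ?thesis
      by (simp add: admissible_def valid_config_iff)
  qed
  have "(bounded_step T p)\<^sup>*\<^sup>* (B 0, w) (B n, w)" if "n \<le> d" for n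
    using that
  proof (induction n)
    case (Suc n)
    have leaf: "children T (v @ [n]) = {}"
      using assms by (auto simp: T balanced_tree_def children_def)
    have "bounded_step T p (B n, w) (B (Suc n), w)"
      unfolding bounded_step_def
    proof (intro conjI exI)
      show "relaxed_step T (Some (v @ [n])) (B n, w) (B (Suc n), w)"
        using leaf Suc.prems child_in_tree[of n] by (auto simp: relaxed_step_def B_def)
    qed (use adm Suc.prems in auto)
    with Suc show ?case
      by (auto intro: rtranclp.rtrancl_into_rtrancl)
  qed simp
  from this[of d] have "(bounded_step T p)\<^sup>*\<^sup>* (b, w) (B d, w)"
    by (simp add: B_def)
  also have "bounded_step T p (B d, w) (b(v := 1), w(v := 0))"
  proof (rule pebble_children)
    have "num_pebbles T (b(v := 1), w(v := 0)) = num_pebbles T (b, w) + 1 - b v - w v"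
      using finite_tree v by (simp add: num_pebbles_pair sum.remove[of T v])
    moreover have "0 \<le> b v" "0 \<le> w v"
      using valid v by (auto simp: valid_config_iff)
    ultimately have "num_pebbles T (b(v := 1), w(v := 0)) \<le> p"
      using num d by simp
    then show "admissible T p (b(v := 1), w(v := 0))"
      using valid by (auto simp: admissible_def valid_config_iff)
    show "B d (v @ [i]) + w (v @ [i]) = 1" if "i < d" for i
      using that clear[OF child_in_tree[OF that]] by (simp add: B_def strict_prefix_def)
    show "(b(v := 1)) x \<le> B d x \<and> w x \<le> (w(v := 0)) x" if "x \<noteq> v" for x
      using that by (simp add: B_def on_children_def)
  qed (use adm in auto)
  finally show "(bounded_step T p)\<^sup>*\<^sup>* (b, w) (b(v := 1), \<lambda>x. (w(v := 0)) x + 0)"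
    by (simp add: fun_upd_def)
qed (simp_all add: card_children_tree)

text \<open>While one child is treated with \<open>L\<close> pebbles, the other children hold at
  most \<open>(d - 1) / 2\<close> altogether; this is the whole increase per level. What is left
  behind is half a white pebble on each child but the last, together with the white pebbles left
  below the last child.\<close>

lemma strategy_node:
  assumes sub: "\<And>i. i < d \<Longrightarrow> strategy T p L (v @ [i]) (F i)"
    and card: "\<And>i. i < d \<Longrightarrow> card (children T (v @ [i])) = d"
  shows "strategy T p (L + (real d - 1) / 2) v (\<lambda>x. on_children v (d - 1) (1 / 2) x + F (d - 1) x)"
proof -
  define H where "H n = on_children v n (1 / 2)" for n
  define e where "e = d - 1"
  have e: "e < d" "real e = real d - 1" "Suc e = d"
    using d by (auto simp: e_def)
  note S = strategyD[OF sub]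
  have sumF: "sum (F i) T \<le> L - real d" if "i < d" for i
    using S(3)[OF that] card[OF that] by simp
  have H0: "0 \<le> H n x" for n x
    by (simp add: H_def on_children_def)
  have sumH: "sum (H n) T = real n / 2" if "n \<le> d" for n
    unfolding H_def using that child_in_tree by (subst sum_on_children[OF finite_tree]) auto
  have F_child: "F i (v @ [j]) = 0" if "i < d" for i j
    using S(2)[OF that, of "v @ [j]"] by (auto simp: strict_prefix_def)
  have F_self: "F i v = 0" if "i < d" for i
    using S(2)[OF that, of v] by (auto simp: strict_prefix_def prefix_def)
  have sp: "strict_prefix v (v @ [i])" for i
    by (auto simp: strict_prefix_def)
  have sp2: "strict_prefix v x \<and> H n x = 0" if "strict_prefix (v @ [i]) x" for i n x
    using that by (auto simp: H_def on_children_def strict_prefix_def prefix_def)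
  show ?thesis
    unfolding strategy_def H_def[symmetric] e_def[symmetric]
  proof (intro conjI allI impI)
    show "0 \<le> H e x + F e x" for x
      using H0 S(1)[OF e(1)] by simp
    show "H e x + F e x = 0" if "\<not> strict_prefix v x" for x
    proof -
      have "\<not> strict_prefix (v @ [e]) x"
        using that sp2 by blast
      then show ?thesis
        using S(2)[OF e(1)] that by (simp add: H_def on_children_eq_0)
    qed
    show "(\<Sum>x\<in>T. H e x + F e x) \<le> L + (real d - 1) / 2 - real (card (children T v))"
      using sumF[OF e(1)] sumH[of e] e(2,3)
      by (simp add: sum.distrib card_children_tree diff_divide_distrib)
  next
    fix b w
    assume "clear_below T v (b, w) \<and> valid_config T (b, w) \<and>
      num_pebbles T (b, w) + (L + (real d - 1) / 2) \<le> p"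
    then have clear: "\<And>x. x \<in> T \<Longrightarrow> strict_prefix v x \<Longrightarrow> b x = 0 \<and> w x = 0"
      and valid: "valid_config T (b, w)"
      and num: "num_pebbles T (b, w) + (L + (real d - 1) / 2) \<le> p"
      by (auto simp: clear_below_def)
    have nonneg: "0 \<le> b x" "0 \<le> w x" "b x + w x \<le> 1" if "x \<in> T" for x
      using valid that by (auto simp: valid_config_iff)
    have child0: "b (v @ [i]) = 0" "w (v @ [i]) = 0" if "i < d" for i
      using clear[OF child_in_tree[OF that] sp] by auto
    define B where "B n = (\<lambda>x. b x + H n x)" for n
    define W where "W n = (\<lambda>x. w x + H n x)" for n
    have valid_BW: "valid_config T (B n, w)" "valid_config T (b, W n)" if "n \<le> d" for n
    proof -
      have "b x + H n x + w x \<le> 1" if "x \<in> T" for x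
        using nonneg[OF that] clear[OF that] sp by (auto simp: H_def on_children_def)
      then show "valid_config T (B n, w)" "valid_config T (b, W n)"
        using nonneg H0 by (auto simp: valid_config_iff B_def W_def add_nonneg_nonneg add.commute add.left_commute)
    qed
    have num_BW: "num_pebbles T (B n, w) + L \<le> p" "num_pebbles T (b, W n) + L \<le> p"
      if "n \<le> e" for n
    proof -
      have "sum (H n) T = real n / 2" "real n \<le> real d - 1"
        using that sumH[of n] e by linarith+
      then have "sum (H n) T \<le> (real d - 1) / 2"
        by simp
      then show "num_pebbles T (B n, w) + L \<le> p" "num_pebbles T (b, W n) + L \<le> p"
        using num unfolding num_pebbles_pair B_def W_def sum.distrib by linarith+
    qed
    have clear_BW: "clear_below T (v @ [i]) (B n, w)" "clear_below T (v @ [i]) (b, W n)" for i n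
      using clear sp2 by (auto simp: clear_below_def B_def W_def)
    have L_nonneg: "0 \<le> L"
      using sumF[OF e(1)] sum_nonneg[of T "F e"] S(1)[OF e(1)] by (meson diff_ge_0_iff_ge of_nat_0_le_iff order_trans)
    have adm: "admissible T p (B n, w)" "admissible T p (b, W n)" if "n \<le> e" for n
      using valid_BW[of n] num_BW[OF that] that e L_nonneg by (auto simp: admissible_def)
    \<comment> \<open>Child \<open>n\<close> is blackened completely, reduced to half a pebble, and
      only then are the white pebbles left below it removed.\<close>
    have half: "(bounded_step T p)\<^sup>*\<^sup>* (B 0, w) (B n, w)" if "n \<le> e" for n
      using that
    proof (induction n)
      case (Suc n)
      let ?x = "v @ [n]"
      have n: "n < d" "n \<le> e" "Suc n \<le> d"
        using Suc.prems e by auto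
      have w_eq: "(\<lambda>x. (w(?x := 0)) x + F n x) = (\<lambda>x. w x + F n x)"
        using child0[OF n(1)] by auto
      have "(bounded_step T p)\<^sup>*\<^sup>* (B n, w) ((B n)(?x := 1), \<lambda>x. w x + F n x)"
        using S(4)[OF n(1) clear_BW(1) valid_BW(1) num_BW(1)] n unfolding w_eq by auto
      moreover have "bounded_step T p ((B n)(?x := 1), \<lambda>x. w x + F n x) (B (Suc n), \<lambda>x. w x + F n x)"
      proof (rule bounded_step_decrease)
        show "admissible T p ((B n)(?x := 1), \<lambda>x. w x + F n x)"
          by (rule admissible_reach[OF calculation adm(1)[OF n(2)]])
        show "0 \<le> B (Suc n) x \<and> B (Suc n) x \<le> ((B n)(?x := 1)) x" if "x \<in> T" for x
          using nonneg[OF that] H0[of "Suc n" x] child0[OF n(1)]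
          by (cases "x = ?x") (auto simp: B_def H_def)
      qed simp
      moreover have "(bounded_step T p)\<^sup>*\<^sup>* (B (Suc n), \<lambda>x. w x + F n x) (B (Suc n), w)"
        using S(5)[OF n(1) clear_BW(1) valid_BW(1) num_BW(1)] n Suc.prems by auto
      ultimately have "(bounded_step T p)\<^sup>*\<^sup>* (B n, w) (B (Suc n), w)"
        by (meson rtranclp.rtrancl_into_rtrancl rtranclp_trans)
      with Suc.IH[OF n(2)] show ?case
        by (rule rtranclp_trans)
    qed simp
    \<comment> \<open>The last child stays fully black, and the white pebbles below it are left
      alone: removing them now would need \<open>L\<close> pebbles on top of this full one.\<close>
    let ?x = "v @ [e]"
    have w_eq: "(\<lambda>x. (w(?x := 0)) x + F e x) = (\<lambda>x. w x + F e x)"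
      using child0[OF e(1)] by auto
    have "(bounded_step T p)\<^sup>*\<^sup>* (b, w) (B e, w)"
      using half[of e] by (simp add: B_def H_def)
    also have "(bounded_step T p)\<^sup>*\<^sup>* (B e, w) ((B e)(?x := 1), \<lambda>x. w x + F e x)"
      using S(4)[OF e(1) clear_BW(1) valid_BW(1) num_BW(1), of e] e unfolding w_eq by auto
    finally have r1: "(bounded_step T p)\<^sup>*\<^sup>* (b, w) ((B e)(?x := 1), \<lambda>x. w x + F e x)" .
    have adm0: "admissible T p (b, w)"
      using adm(1)[of 0] by (simp add: B_def H_def)
    have adm1: "admissible T p ((B e)(?x := 1), \<lambda>x. w x + F e x)"
      by (rule admissible_reach[OF r1 adm0])
    let ?W = "\<lambda>x. w x + (H e x + F e x)"
    have sums: "sum (H e) T = (real d - 1) / 2" "sum (F e) T \<le> L - real d"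
      using sumH[of e] sumF[OF e(1)] e by auto
    \<comment> \<open>Here all children have value 1, so they and the white pebbles
      \<open>F e\<close> amount to at most \<open>d + (L - d) = L\<close>. This is what the bound on
      \<open>sum f T\<close> in \<open>strategy\<close> is for.\<close>
    have adm2: "admissible T p ((B e)(?x := 1), ?W)"
      unfolding admissible_def
    proof
      show "valid_config T ((B e)(?x := 1), ?W)"
        unfolding valid_config_iff
      proof
        fix x assume x: "x \<in> T"
        have le: "0 \<le> ((B e)(?x := 1)) x" "((B e)(?x := 1)) x + (w x + F e x) \<le> 1"
          using adm1 x by (auto simp: admissible_def valid_config_iff)
        have "((B e)(?x := 1)) x + ?W x \<le> 1"
        proof (cases "\<exists>j<e. x = v @ [j]")
          case True
          then show ?thesis
            using F_child[OF e(1)] child0 e(1) by (auto simp: B_def H_def)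
        next
          case False
          then have "H e x = 0"
            by (auto simp: H_def on_children_def)
          then show ?thesis
            using le by simp
        qed
        then show "0 \<le> fst ((B e)(?x := 1), ?W) x \<and> 0 \<le> snd ((B e)(?x := 1), ?W) x \<and>
            fst ((B e)(?x := 1), ?W) x + snd ((B e)(?x := 1), ?W) x \<le> 1"
          using le(1) nonneg(2)[OF x] H0[of e x] S(1)[OF e(1), of x] by simp
      qed
      have "sum ((B e)(?x := 1)) T = sum (B e) T + 1"
        using finite_tree child_in_tree[OF e(1)] child0[OF e(1)]
        by (simp add: sum.remove[of T ?x] B_def H_def)
      then show "num_pebbles T ((B e)(?x := 1), ?W) \<le> p"
        using num sums d by (simp add: num_pebbles_pair B_def sum.distrib field_simps)
    qed
    have "bounded_step T p ((B e)(?x := 1), \<lambda>x. w x + F e x) ((B e)(?x := 1), ?W)"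
      unfolding bounded_step_def
    proof (intro conjI exI)
      show "relaxed_step T None ((B e)(?x := 1), \<lambda>x. w x + F e x) ((B e)(?x := 1), ?W)"
        using H0 by (simp add: relaxed_step_def)
    qed (fact adm1 adm2)+
    moreover have "bounded_step T p ((B e)(?x := 1), ?W) (b(v := 1), \<lambda>x. (w(v := 0)) x + (H e x + F e x))"
    proof (rule pebble_children[OF adm2])
      show "admissible T p (b(v := 1), \<lambda>x. (w(v := 0)) x + (H e x + F e x))"
        unfolding admissible_def
      proof
        have "0 \<le> fst (b(v := 1), \<lambda>x. (w(v := 0)) x + (H e x + F e x)) x \<and>
            0 \<le> snd (b(v := 1), \<lambda>x. (w(v := 0)) x + (H e x + F e x)) x \<and>
            fst (b(v := 1), \<lambda>x. (w(v := 0)) x + (H e x + F e x)) x +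
            snd (b(v := 1), \<lambda>x. (w(v := 0)) x + (H e x + F e x)) x \<le> 1" if "x \<in> T" for x
        proof (cases "x = v")
          case True
          then show ?thesis
            using F_self[OF e(1)] by (simp add: H_def)
        next
          case False
          have "b x \<le> ((B e)(?x := 1)) x"
            using H0[of e x] child0[OF e(1)] by (auto simp: B_def)
          moreover have "((B e)(?x := 1)) x + ?W x \<le> 1"
            using adm2 that by (auto simp: admissible_def valid_config_iff)
          ultimately show ?thesis
            using False nonneg[OF that] H0[of e x] S(1)[OF e(1), of x] by simp
        qed
        then show "valid_config T (b(v := 1), \<lambda>x. (w(v := 0)) x + (H e x + F e x))"
          unfolding valid_config_iff by blast
        have "sum (b(v := 1)) T = sum b T - b v + 1" "sum (w(v := 0)) T = sum w T - w v"
          using finite_tree v by (simp_all add: sum.remove[of T v])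
        then show "num_pebbles T (b(v := 1), \<lambda>x. (w(v := 0)) x + (H e x + F e x)) \<le> p"
          using num sums d nonneg[OF v(1)] by (simp add: num_pebbles_pair sum.distrib field_simps)
      qed
      show "((B e)(?x := 1)) (v @ [i]) + ?W (v @ [i]) = 1" if "i < d" for i
      proof (cases "i = e")
        case False
        then have "i < e"
          using that e by simp
        then show ?thesis
          using child0[OF that] F_child[OF e(1)] by (simp add: B_def H_def)
      qed (use child0[OF e(1)] F_child[OF e(1)] in \<open>simp add: H_def\<close>)
      show "(b(v := 1)) x \<le> ((B e)(?x := 1)) x \<and> ?W x \<le> (w(v := 0)) x + (H e x + F e x)"
        if "x \<noteq> v" for x
        using that H0[of e x] child0[OF e(1)] by (auto simp: B_def)
    qed
    ultimately show "(bounded_step T p)\<^sup>*\<^sup>* (b, w) (b(v := 1), \<lambda>x. (w(v := 0)) x + (H e x + F e x))"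
      using r1 by (meson rtranclp.rtrancl_into_rtrancl)
    have "(bounded_step T p)\<^sup>*\<^sup>* (b, \<lambda>x. W e x + F e x) (b, W e)"
      using S(5)[OF e(1) clear_BW(2) valid_BW(2) num_BW(2), of e] e by auto
    \<comment> \<open>Half a white pebble on a child disappears when the child is blackened. The
      black pebble is then discarded, and the white ones left below are removed.\<close>
    moreover have "(bounded_step T p)\<^sup>*\<^sup>* (b, W n) (b, W 0)" if "n \<le> e" for n
      using that
    proof (induction n)
      case (Suc n)
      let ?x = "v @ [n]"
      have n: "n < d" "n \<le> e" "Suc n \<le> d"
        using Suc.prems e by auto
      have w_eq: "(\<lambda>x. ((W (Suc n))(?x := 0)) x + F n x) = (\<lambda>x. W n x + F n x)"
        using child0[OF n(1)] by (auto simp: W_def H_def)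
      have "(bounded_step T p)\<^sup>*\<^sup>* (b, W (Suc n)) (b(?x := 1), \<lambda>x. W n x + F n x)"
        using S(4)[OF n(1) clear_BW(2) valid_BW(2) num_BW(2), of "Suc n"] n Suc.prems unfolding w_eq by auto
      moreover have "bounded_step T p (b(?x := 1), \<lambda>x. W n x + F n x) (b, \<lambda>x. W n x + F n x)"
      proof (rule bounded_step_decrease)
        show "admissible T p (b(?x := 1), \<lambda>x. W n x + F n x)"
          by (rule admissible_reach[OF calculation adm(2)[OF Suc.prems]])
      qed (use nonneg child0[OF n(1)] in auto)
      moreover have "(bounded_step T p)\<^sup>*\<^sup>* (b, \<lambda>x. W n x + F n x) (b, W n)"
        using S(5)[OF n(1) clear_BW(2) valid_BW(2) num_BW(2), of n] n Suc.prems by auto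
      ultimately have "(bounded_step T p)\<^sup>*\<^sup>* (b, W (Suc n)) (b, W n)"
        by (meson rtranclp.rtrancl_into_rtrancl rtranclp_trans)
      then show ?case
        using Suc.IH[OF n(2)] by (rule rtranclp_trans)
    qed simp
    from this[OF order_refl] have "(bounded_step T p)\<^sup>*\<^sup>* (b, W e) (b, w)"
      by (simp add: W_def H_def)
    ultimately have "(bounded_step T p)\<^sup>*\<^sup>* (b, \<lambda>x. W e x + F e x) (b, w)"
      by (rule rtranclp_trans)
    then show "(bounded_step T p)\<^sup>*\<^sup>* (b, \<lambda>x. w x + (H e x + F e x)) (b, w)"
      by (simp add: W_def add.assoc)
  qed
qed

end

lemma strategy_exists:
  assumes "d \<ge> 2" "v \<in> balanced_tree d h" "length v + k + 2 = h"
  shows "\<exists>f. strategy (balanced_tree d h) p (real d + real k * (real d - 1) / 2) v f"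
  using assms(2,3)
proof (induction k arbitrary: v)
  case 0
  then show ?case
    using strategy_leaves[OF refl, of v d h p] assms(1) by auto
next
  case (Suc k)
  let ?T = "balanced_tree d h"
  let ?L = "real d + real k * (real d - 1) / 2"
  have v: "Suc (length v) < h"
    using Suc.prems by simp
  note tree = child_in_tree[OF refl Suc.prems(1) v assms(1)]
  have "\<exists>f. strategy ?T p ?L (v @ [i]) f" if "i < d" for i
    using Suc.prems(2) tree[OF that] by (intro Suc.IH) auto
  then obtain F where F: "\<And>i. i < d \<Longrightarrow> strategy ?T p ?L (v @ [i]) (F i)"
    by metis
  have "card (children ?T (v @ [i])) = d" if "i < d" for i
    using Suc.prems(2) tree[OF that] assms(1) by (intro card_children_tree[OF refl]) auto
  from strategy_node[OF refl Suc.prems(1) v assms(1) F this]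
  have "strategy ?T p (?L + (real d - 1) / 2) v (\<lambda>x. on_children v (d - 1) (1 / 2) x + F (d - 1) x)"
    by blast
  moreover have "?L + (real d - 1) / 2 = real d + real (Suc k) * (real d - 1) / 2"
    by (simp add: field_simps)
  ultimately show ?case
    by auto
qed

lemma has_pebbling_balanced_tree:
  assumes "d \<ge> 2" "h \<ge> 2"
  shows "has_pebbling (balanced_tree d h) ((real d - 1) * real h / 2 + 1)"
proof -
  let ?T = "balanced_tree d h" and ?p = "(real d - 1) * real h / 2 + 1"
  have tree: "finite ?T" "[] \<in> ?T"
    using is_tree_balanced_tree[of h d] assms by (auto simp: is_tree_def)
  have h: "real (h - 2) = real h - 2"
    using assms by simp
  have p: "real d + real (h - 2) * (real d - 1) / 2 = ?p"
    unfolding h by (simp add: field_simps)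
  have "length ([] :: node) + (h - 2) + 2 = h"
    using assms(2) by simp
  from strategy_exists[OF assms(1) tree(2) this, of ?p, unfolded p]
  obtain f where f: "strategy ?T ?p ?p [] f" ..
  let ?z = "\<lambda>x :: node. 0 :: real"
  have "0 \<le> ?p"
    using assms by simp
  have z: "clear_below ?T [] (?z, ?z)" "valid_config ?T (?z, ?z)" "num_pebbles ?T (?z, ?z) + ?p \<le> ?p"
    "admissible ?T ?p (?z, ?z)" "zero_config ?T (?z, ?z)"
    using \<open>0 \<le> ?p\<close>
    by (auto simp: clear_below_def valid_config_iff num_pebbles_pair admissible_def zero_config_iff)
  have r: "(bounded_step ?T ?p)\<^sup>*\<^sup>* (?z, ?z) (?z([] := 1), f)"
    using strategyD(4)[OF f z(1-3)] by (simp add: fun_upd_def)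
  have "bounded_step ?T ?p (?z([] := 1), f) (?z, f)"
    by (rule bounded_step_decrease[OF admissible_reach[OF r z(4)]]) auto
  moreover have "(bounded_step ?T ?p)\<^sup>*\<^sup>* (?z, f) (?z, ?z)"
    using strategyD(5)[OF f z(1-3)] by simp
  ultimately have "(bounded_step ?T ?p)\<^sup>*\<^sup>* (?z([] := 1), f) (?z, ?z)"
    by (rule converse_rtranclp_into_rtranclp)
  then show ?thesis
    by (rule has_pebbling_bounded_steps[OF tree r _ z(4) z(5) z(5)]) simp
qed

section \<open>Cutting off the black pebbles from the leaves\<close>

text \<open>The non-leaves. Leaves carry no weight because they can be pebbled at any time.\<close>

definition inner :: "nat \<Rightarrow> nat \<Rightarrow> node set" where
  "inner d h = {v. set v \<subseteq> {..<d} \<and> length v + 2 \<le> h}"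

text \<open>Being hidden means that nodes with \<open>u + w\<close> at least 1, called full, meet
  every path from \<open>v\<close> down to a parent of leaves. A parent of leaves itself can only be
  hidden by being full.\<close>

inductive hidden :: "nat \<Rightarrow> nat \<Rightarrow> (node \<Rightarrow> real) \<Rightarrow> (node \<Rightarrow> real) \<Rightarrow> node \<Rightarrow> bool"
  for d h u w where
  full: "1 \<le> u v + w v \<Longrightarrow> hidden d h u w v"
| below: "length v + 3 \<le> h \<Longrightarrow> (\<And>k. k < d \<Longrightarrow> hidden d h u w (v @ [k])) \<Longrightarrow> hidden d h u w v"

definition hidden_below :: "nat \<Rightarrow> nat \<Rightarrow> (node \<Rightarrow> real) \<Rightarrow> (node \<Rightarrow> real) \<Rightarrow> node \<Rightarrow> bool" where
  "hidden_below d h u w v \<longleftrightarrow> length v + 3 \<le> h \<and> (\<forall>k<d. hidden d h u w (v @ [k]))"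

text \<open>A black value is paid for by weight on its own node, or else hidden children make up for
  it.\<close>

definition blocks :: "nat \<Rightarrow> nat \<Rightarrow> (node \<Rightarrow> real) \<Rightarrow> config \<Rightarrow> bool" where
  "blocks d h u c \<longleftrightarrow> (\<forall>v\<in>inner d h. fst c v \<le> u v \<or> hidden_below d h u (snd c) v)"

definition upper_sum :: "nat \<Rightarrow> nat \<Rightarrow> (node \<Rightarrow> real) \<Rightarrow> nat \<Rightarrow> real" where
  "upper_sum d h u n = (\<Sum>v | v \<in> inner d h \<and> length v \<le> n. u v)"

text \<open>
  Nodes are ordered by depth: depth at most \<open>n\<close> is height at least \<open>h - n\<close>. An arbitrarily small
  positive weight at depth \<open>n\<close> already incurs the full level term.
\<close>

definition within_budget :: "nat \<Rightarrow> nat \<Rightarrow> real \<Rightarrow> (node \<Rightarrow> real) \<Rightarrow> bool" where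
  "within_budget d h K u \<longleftrightarrow>
     (\<forall>n. n + 2 \<le> h \<longrightarrow> upper_sum d h u n > 0 \<longrightarrow>
       (real d - 1) * (real h - real n) + 2 * upper_sum d h u n \<le> K)"

text \<open>The part of the subtree at \<open>v\<close> down to, and including, the first full node
  on each path. Its full nodes are the cut that can hide \<open>v\<close>.\<close>

definition visible :: "nat \<Rightarrow> nat \<Rightarrow> (node \<Rightarrow> real) \<Rightarrow> (node \<Rightarrow> real) \<Rightarrow> node \<Rightarrow> node set" where
  "visible d h u w v =
     {x \<in> inner d h. prefix v x \<and> (\<forall>y. prefix v y \<and> strict_prefix y x \<longrightarrow> u y + w y < 1)}"

lemma finite_inner [simp]: "finite (inner d h)"
proof -
  have "inner d h \<subseteq> {v. set v \<subseteq> {..<d} \<and> length v \<le> h}"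
    by (auto simp: inner_def)
  then show ?thesis
    using finite_lists_length_le[of "{..<d}" h] finite_subset by blast
qed

lemma child_inner: "v \<in> inner d h \<Longrightarrow> length v + 3 \<le> h \<Longrightarrow> k < d \<Longrightarrow> v @ [k] \<in> inner d h"
  by (auto simp: inner_def)

lemma prefix_inner: "x \<in> inner d h \<Longrightarrow> prefix v x \<Longrightarrow> v \<in> inner d h"
  by (auto simp: inner_def prefix_def)

section \<open>Visible regions\<close>

lemma visible_inner: "visible d h u w v \<subseteq> inner d h"
  by (auto simp: visible_def)

lemma finite_visible [simp]: "finite (visible d h u w v)"
  using visible_inner finite_inner by (rule finite_subset)

lemma visible_self: "v \<in> inner d h \<Longrightarrow> v \<in> visible d h u w v"
  using prefix_order.le_less_trans by (auto simp: visible_def)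

lemma visible_full: "v \<in> inner d h \<Longrightarrow> 1 \<le> u v + w v \<Longrightarrow> visible d h u w v = {v}"
proof -
  assume v: "v \<in> inner d h" "1 \<le> u v + w v"
  have "x = v" if "x \<in> visible d h u w v" for x
  proof (rule ccontr)
    assume "x \<noteq> v"
    then have "strict_prefix v x"
      using that by (auto simp: visible_def strict_prefix_def)
    then show False
      using that v by (force simp: visible_def)
  qed
  then show ?thesis
    using visible_self[OF v(1)] by blast
qed

lemma visible_trans:
  assumes "c \<in> visible d h u w a" "x \<in> visible d h u w c"
  shows "x \<in> visible d h u w a"
proof -
  have "u y + w y < 1" if "prefix a y" "strict_prefix y x" for y
  proof (cases "prefix c y")
    case True
    then show ?thesis
      using assms that by (auto simp: visible_def)
  next
    case False
    then have "strict_prefix y c"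
      using assms that prefix_same_cases[of y x c]
      by (auto simp: visible_def strict_prefix_def)
    then show ?thesis
      using assms that by (auto simp: visible_def)
  qed
  then show ?thesis
    using assms by (auto simp: visible_def)
qed

lemma visible_between:
  assumes "x \<in> visible d h u w a" "prefix c x" "prefix a c"
  shows "c \<in> visible d h u w a"
  using assms prefix_inner[of x d h c] prefix_order.less_le_trans[of _ c x]
  by (auto simp: visible_def)

text \<open>Regions that meet are nested, so the maximal ones among them are disjoint and can be
  summed over separately.\<close>

lemma visible_comparable:
  assumes "x \<in> visible d h u w a" "x \<in> visible d h u w c"
  shows "c \<in> visible d h u w a \<or> a \<in> visible d h u w c"
proof -
  have "prefix a x" "prefix c x"
    using assms by (auto simp: visible_def)
  then show ?thesis
    using prefix_same_cases[of a x c] visible_between assms by blast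
qed

lemma visible_child:
  assumes "v \<in> visible d h u w a" "u v + w v < 1" "length v + 3 \<le> h" "k < d"
  shows "v @ [k] \<in> visible d h u w a"
  unfolding visible_def
proof (intro CollectI conjI allI impI)
  show "v @ [k] \<in> inner d h" "prefix a (v @ [k])"
    using assms child_inner[of v d h k] by (auto simp: visible_def)
  fix y assume "prefix a y \<and> strict_prefix y (v @ [k])"
  then have "prefix a y" "y = v \<or> strict_prefix y v"
    by (auto simp: strict_prefix_def prefix_snoc)
  then show "u y + w y < 1"
    using assms(1,2) by (auto simp: visible_def)
qed

lemma visible_decompose:
  assumes "v \<in> inner d h" "u v + w v < 1" "length v + 3 \<le> h"
  shows "visible d h u w v = insert v (\<Union>k<d. visible d h u w (v @ [k]))"
proof (rule set_eqI)
  fix x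
  have "x \<in> (\<Union>k<d. visible d h u w (v @ [k]))" if x: "x \<in> visible d h u w v" "x \<noteq> v"
  proof -
    obtain zs where zs: "x = v @ zs"
      using x by (auto simp: visible_def prefix_def)
    then obtain k ys where "zs = k # ys"
      using x by (cases zs) auto
    then have k: "x = v @ k # ys"
      using zs by simp
    then have "k < d"
      using x by (auto simp: visible_def inner_def)
    moreover have "x \<in> visible d h u w (v @ [k])"
      using x k by (auto simp: visible_def dest: append_prefixD)
    ultimately show ?thesis
      by blast
  qed
  moreover have "x \<in> visible d h u w v" if "x \<in> visible d h u w (v @ [k])" "k < d" for k
    using visible_trans[OF visible_child[where u=u and w=w, OF visible_self[OF assms(1)] assms(2,3)]] that by blast
  ultimately show "x \<in> visible d h u w v \<longleftrightarrow> x \<in> insert v (\<Union>k<d. visible d h u w (v @ [k]))"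
    using visible_self[OF assms(1)] by blast
qed

lemma visible_children_disjoint:
  "i \<noteq> j \<Longrightarrow> visible d h u w (v @ [i]) \<inter> visible d h u w (v @ [j]) = {}"
  by (auto simp: visible_def prefix_def)

lemma hidden_iff: "hidden d h u w v \<longleftrightarrow> 1 \<le> u v + w v \<or> hidden_below d h u w v"
  by (subst hidden.simps) (auto simp: hidden_below_def)

text \<open>The two rules of \<open>hidden\<close> overlap at full nodes. Making the cases exclusive
  lets \<open>visible_full\<close> or \<open>visible_decompose\<close> describe the region in each
  of them.\<close>

lemma hidden_induct [consumes 2, case_names full below]:
  assumes "hidden d h u w v" "v \<in> inner d h"
    and "\<And>v. v \<in> inner d h \<Longrightarrow> 1 \<le> u v + w v \<Longrightarrow> P v"
    and "\<And>v. v \<in> inner d h \<Longrightarrow> u v + w v < 1 \<Longrightarrow> length v + 3 \<le> h \<Longrightarrow>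
      (\<And>k. k < d \<Longrightarrow> hidden d h u w (v @ [k])) \<Longrightarrow> (\<And>k. k < d \<Longrightarrow> P (v @ [k])) \<Longrightarrow> P v"
  shows "P v"
  using assms(1,2)
proof induction
  case (full v)
  then show ?case
    using assms(3) by blast
next
  case (below v)
  then show ?case
    using assms(3)[of v] assms(4)[of v] child_inner by (cases "1 \<le> u v + w v") auto
qed

text \<open>The visible full nodes form a cut below \<open>v\<close>, so it is enough to hide each
  of them again.\<close>

lemma hidden_mono:
  assumes "hidden d h u w v" "v \<in> inner d h"
    and "\<And>x. x \<in> visible d h u w v \<Longrightarrow> 1 \<le> u x + w x \<Longrightarrow> hidden d h u' w' x"
  shows "hidden d h u' w' v"
  using assms
proof (induction rule: hidden_induct)
  case (full v)
  then show ?case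
    using visible_self by blast
next
  case (below v)
  have "hidden d h u' w' (v @ [k])" if "k < d" for k
    using below that visible_decompose[where u=u and w=w, OF below(1-3)] by blast
  then show ?case
    by (rule hidden.below[OF below(3)])
qed

lemma hidden_below_mono:
  assumes "hidden_below d h u w v" "v \<in> inner d h" "u v + w v < 1"
    and "\<And>x. x \<in> visible d h u w v \<Longrightarrow> 1 \<le> u x + w x \<Longrightarrow> hidden d h u' w' x"
  shows "hidden_below d h u' w' v"
  unfolding hidden_below_def
proof (intro conjI allI impI)
  show l: "length v + 3 \<le> h"
    using assms(1) by (simp add: hidden_below_def)
  fix k assume k: "k < d"
  show "hidden d h u' w' (v @ [k])"
  proof (rule hidden_mono[where u=u and w=w])
    show "hidden d h u w (v @ [k])" "v @ [k] \<in> inner d h"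
      using assms(1) k child_inner[OF assms(2) l k] by (auto simp: hidden_below_def)
    show "hidden d h u' w' x" if "x \<in> visible d h u w (v @ [k])" "1 \<le> u x + w x" for x
      using assms(4) that visible_decompose[where u=u and w=w, OF assms(2,3) l] k by blast
  qed
qed

section \<open>Counting visible full nodes\<close>

text \<open>
  The visible full nodes are the leaves of a tree whose internal nodes all have \<open>d\<close> children.
\<close>

lemma card_visible_decompose:
  assumes "v \<in> inner d h" "u v + w v < 1" "length v + 3 \<le> h" "\<not> P v"
  shows "card {x \<in> visible d h u w v. P x} = (\<Sum>k<d. card {x \<in> visible d h u w (v @ [k]). P x})"
proof -
  have "{x \<in> visible d h u w v. P x} = (\<Union>k<d. {x \<in> visible d h u w (v @ [k]). P x})"
    using assms(4) unfolding visible_decompose[where u=u and w=w, OF assms(1-3)] by blast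
  also have "card \<dots> = (\<Sum>k<d. card {x \<in> visible d h u w (v @ [k]). P x})"
    using visible_children_disjoint by (intro card_UN_disjoint) (auto, blast)
  finally show ?thesis .
qed

lemma card_full_pos:
  assumes "hidden d h u w v" "v \<in> inner d h" "d \<ge> 1"
  shows "1 \<le> card {x \<in> visible d h u w v. 1 \<le> u x + w x}"
  using assms
proof (induction rule: hidden_induct)
  case (full v)
  then have "card {v} \<le> card {x \<in> visible d h u w v. 1 \<le> u x + w x}"
    using visible_self by (intro card_mono) auto
  then show ?case
    by simp
next
  case (below v)
  have "1 \<le> card {x \<in> visible d h u w (v @ [0]). 1 \<le> u x + w x}"
    using below by simp
  also have "\<dots> \<le> (\<Sum>k<d. card {x \<in> visible d h u w (v @ [k]). 1 \<le> u x + w x})"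
    using below by (intro member_le_sum) auto
  also have "\<dots> = card {x \<in> visible d h u w v. 1 \<le> u x + w x}"
    by (rule card_visible_decompose[where u=u and w=w, OF below(1-3), symmetric]) (use below(2) in simp)
  finally show ?case .
qed

lemma visible_level:
  assumes "v \<in> inner d h"
  shows "{x \<in> visible d h u w v. P x \<and> length x = length v} = {x. x = v \<and> P v}"
  using visible_self[OF assms] by (auto simp: visible_def prefix_def)

lemma visible_length: "x \<in> visible d h u w v \<Longrightarrow> length v \<le> length x"
  by (auto simp: visible_def prefix_def)

lemma visible_full_length:
  assumes "u v + w v < 1"
  shows "{x \<in> visible d h u w v. 1 \<le> u x + w x \<and> length v < length x} = {x \<in> visible d h u w v. 1 \<le> u x + w x}"
proof -
  have "length v < length x" if "x \<in> visible d h u w v" "1 \<le> u x + w x" for x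
  proof -
    have "x \<noteq> v" "prefix v x"
      using that assms by (auto simp: visible_def)
    then show ?thesis
      by (simp add: strict_prefix_def prefix_length_less)
  qed
  then show ?thesis
    by blast
qed

text \<open>Each non-full visible node of depth \<open>m\<close> has a full visible node strictly
  below it, and the subtrees at one depth are disjoint.\<close>

lemma card_nonfull_level_le:
  assumes "hidden d h u w v" "v \<in> inner d h" "d \<ge> 1"
  shows "card {x \<in> visible d h u w v. u x + w x < 1 \<and> length x = m} \<le>
    card {x \<in> visible d h u w v. 1 \<le> u x + w x \<and> m < length x}"
  using assms
proof (induction rule: hidden_induct)
  case (full v)
  then have "{x \<in> visible d h u w v. u x + w x < 1 \<and> length x = m} = {}"
    by (auto simp: visible_full)
  then show ?case
    by (simp only: card.empty le0)
next
  case (below v)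
  consider "m < length v" | "m = length v" | "m > length v"
    by linarith
  then show ?case
  proof cases
    case 1
    then have "{x \<in> visible d h u w v. u x + w x < 1 \<and> length x = m} = {}"
      using visible_length by fastforce
    then show ?thesis
      by (simp only: card.empty le0)
  next
    case 2
    have "hidden d h u w v"
      using below by (auto intro!: hidden.below[of v])
    then have "1 \<le> card {x \<in> visible d h u w v. 1 \<le> u x + w x}"
      using below by (intro card_full_pos)
    moreover have "{x \<in> visible d h u w v. u x + w x < 1 \<and> length x = length v} = {v}"
      using visible_level[OF below(1), where u=u and w=w and P="\<lambda>x. u x + w x < 1"] below(2) by simp
    ultimately show ?thesis
      unfolding 2 visible_full_length[where u=u and w=w, OF below(2)] by simp
  next
    case 3
    have "card {x \<in> visible d h u w v. u x + w x < 1 \<and> length x = m} =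
        (\<Sum>k<d. card {x \<in> visible d h u w (v @ [k]). u x + w x < 1 \<and> length x = m})"
      by (rule card_visible_decompose[where u=u and w=w, OF below(1-3)]) (use 3 in simp)
    also have "\<dots> \<le> (\<Sum>k<d. card {x \<in> visible d h u w (v @ [k]). 1 \<le> u x + w x \<and> m < length x})"
      using below by (intro sum_mono) auto
    also have "\<dots> = card {x \<in> visible d h u w v. 1 \<le> u x + w x \<and> m < length x}"
      by (rule card_visible_decompose[where u=u and w=w, OF below(1-3), symmetric]) (use below(2) in simp)
    finally show ?thesis .
  qed
qed

text \<open>Each node on the path from \<open>v\<close> to \<open>x\<close>, except
  \<open>x\<close>, has \<open>d - 1\<close> children off the path, and every one of these
  contributes a full node. The additional 1 is \<open>x\<close>.\<close>

lemma card_full_ge: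
  assumes "hidden d h u w v" "v \<in> inner d h" "d \<ge> 1"
    and "x \<in> visible d h u w v" "1 \<le> u x + w x"
  shows "(d - 1) * (length x - length v) + 1 \<le> card {x \<in> visible d h u w v. 1 \<le> u x + w x}"
  using assms
proof (induction rule: hidden_induct)
  case (full v)
  then show ?case
    using card_full_pos[OF hidden.full, of u v w d h] by (simp add: visible_full)
next
  case (below v)
  let ?c = "\<lambda>k. card {x \<in> visible d h u w (v @ [k]). 1 \<le> u x + w x}"
  have "x \<noteq> v"
    using below by auto
  then obtain i where i: "i < d" "x \<in> visible d h u w (v @ [i])"
    using below.prems visible_decompose[where u=u and w=w, OF below(1-3)] by auto
  define n where "n = length x - length (v @ [i])"
  have n: "length x - length v = Suc n"
    using visible_length[OF i(2)] by (simp add: n_def)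
  have "(d - 1) * n + 1 \<le> ?c i"
    unfolding n_def by (rule below.IH) (use i below.prems in auto)
  moreover have "(\<Sum>k\<in>{..<d} - {i}. 1) \<le> (\<Sum>k\<in>{..<d} - {i}. ?c k)"
    using below child_inner by (intro sum_mono card_full_pos) auto
  then have "d - 1 \<le> (\<Sum>k\<in>{..<d} - {i}. ?c k)"
    using i(1) by (simp add: card_Diff_singleton)
  moreover have "(\<Sum>k<d. ?c k) = ?c i + (\<Sum>k\<in>{..<d} - {i}. ?c k)"
    using i by (intro sum.remove) auto
  moreover have "card {x \<in> visible d h u w v. 1 \<le> u x + w x} = (\<Sum>k<d. ?c k)"
    by (rule card_visible_decompose[where u=u and w=w, OF below(1-3)]) (use below(2) in simp)
  ultimately show ?case
    unfolding n by simp
qed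

text \<open>The ancestor of \<open>x\<close> at depth \<open>m\<close> has at least
  \<open>(d - 1) * (length x - m) + 1\<close> full nodes below it, and every other non-full visible
  node of depth \<open>m\<close> at least one.\<close>

lemma card_full_below_ge:
  assumes "hidden d h u w v" "v \<in> inner d h" "d \<ge> 1"
    and "x \<in> visible d h u w v" "1 \<le> u x + w x" "length v \<le> m" "m < length x"
  shows "(d - 1) * (length x - m) + card {x \<in> visible d h u w v. u x + w x < 1 \<and> length x = m} \<le>
    card {x \<in> visible d h u w v. 1 \<le> u x + w x \<and> m < length x}"
  using assms
proof (induction rule: hidden_induct)
  case (full v)
  then show ?case
    by (auto simp: visible_full)
next
  case (below v)
  let ?c = "\<lambda>k. card {x \<in> visible d h u w (v @ [k]). 1 \<le> u x + w x \<and> m < length x}"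
  let ?q = "\<lambda>k. card {x \<in> visible d h u w (v @ [k]). u x + w x < 1 \<and> length x = m}"
  have hid: "hidden d h u w v"
    using below by (auto intro!: hidden.below[of v])
  show ?case
  proof (cases "m = length v")
    case True
    have "{x \<in> visible d h u w v. u x + w x < 1 \<and> length x = length v} = {v}"
      using visible_level[OF below(1), where u=u and w=w and P="\<lambda>x. u x + w x < 1"] below(2) by simp
    then show ?thesis
      using card_full_ge[OF hid below(1) below.prems(1-3)]
      unfolding True visible_full_length[where u=u and w=w, OF below(2)] by simp
  next
    case False
    have "x \<noteq> v"
      using below by auto
    then obtain i where i: "i < d" "x \<in> visible d h u w (v @ [i])"
      using below.prems visible_decompose[where u=u and w=w, OF below(1-3)] by auto
    have "(d - 1) * (length x - m) + ?q i \<le> ?c i"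
      by (rule below.IH) (use i below.prems False in auto)
    moreover have "(\<Sum>k\<in>{..<d} - {i}. ?q k) \<le> (\<Sum>k\<in>{..<d} - {i}. ?c k)"
      using below child_inner by (intro sum_mono card_nonfull_level_le) auto
    moreover have "(\<Sum>k<d. ?c k) = ?c i + (\<Sum>k\<in>{..<d} - {i}. ?c k)" "(\<Sum>k<d. ?q k) = ?q i + (\<Sum>k\<in>{..<d} - {i}. ?q k)"
      using i by (intro sum.remove; simp)+
    moreover have "card {x \<in> visible d h u w v. u x + w x < 1 \<and> length x = m} = (\<Sum>k<d. ?q k)"
      by (rule card_visible_decompose[where u=u and w=w, OF below(1-3)]) (use False in simp)
    moreover have "card {x \<in> visible d h u w v. 1 \<le> u x + w x \<and> m < length x} = (\<Sum>k<d. ?c k)"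
      by (rule card_visible_decompose[where u=u and w=w, OF below(1-3)]) (use below(2) in simp)
    ultimately show ?thesis
      by linarith
  qed
qed

lemma upper_sum_diff:
  assumes "R \<subseteq> inner d h" "\<And>x. x \<in> inner d h \<Longrightarrow> x \<notin> R \<Longrightarrow> u' x = u x"
  shows "upper_sum d h u' n = upper_sum d h u n + (\<Sum>x | x \<in> R \<and> length x \<le> n. u' x - u x)"
proof -
  have "upper_sum d h u' n - upper_sum d h u n = (\<Sum>x | x \<in> inner d h \<and> length x \<le> n. u' x - u x)"
    by (simp add: upper_sum_def sum_subtractf)
  also have "\<dots> = (\<Sum>x | x \<in> R \<and> length x \<le> n. u' x - u x)"
    using assms by (intro sum.mono_neutral_right) auto
  finally show ?thesis
    by simp
qed

lemma upper_sum_all: "sum u (inner d h) = upper_sum d h u h"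
  unfolding upper_sum_def by (rule sum.cong) (auto simp: inner_def)

lemma upper_sum_nonneg: "(\<And>x. x \<in> inner d h \<Longrightarrow> 0 \<le> u x) \<Longrightarrow> 0 \<le> upper_sum d h u n"
  unfolding upper_sum_def by (intro sum_nonneg) auto

lemma upper_sum_mono: "(\<And>x. x \<in> inner d h \<Longrightarrow> u x \<le> u' x) \<Longrightarrow> upper_sum d h u n \<le> upper_sum d h u' n"
  unfolding upper_sum_def by (intro sum_mono) auto

lemma within_budget_antimono:
  assumes "within_budget d h K u" "\<And>x. x \<in> inner d h \<Longrightarrow> u' x \<le> u x"
  shows "within_budget d h K u'"
  unfolding within_budget_def
proof (intro allI impI)
  fix n assume "n + 2 \<le> h" "0 < upper_sum d h u' n"
  moreover have "upper_sum d h u' n \<le> upper_sum d h u n"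
    using assms(2) by (rule upper_sum_mono)
  ultimately show "(real d - 1) * (real h - real n) + 2 * upper_sum d h u' n \<le> K"
    using assms(1) unfolding within_budget_def by fastforce
qed

section \<open>Light blocking weightings of a single configuration\<close>

context
  fixes d h :: nat and b w :: "node \<Rightarrow> real"
  assumes d: "1 \<le> d"
    and valid: "\<And>x. x \<in> inner d h \<Longrightarrow> 0 \<le> b x \<and> 0 \<le> w x \<and> b x + w x \<le> 1"
begin

text \<open>
  Lowering \<open>u\<close> to the nearest of these values affects neither blocking nor the budget, and leaves only
  finitely many candidates to minimise over.
\<close>

definition snapped :: "(node \<Rightarrow> real) \<Rightarrow> bool" where
  "snapped u \<longleftrightarrow> (\<forall>x\<in>inner d h. u x \<in> {0, b x, 1 - w x}) \<and> (\<forall>x. x \<notin> inner d h \<longrightarrow> u x = 0)"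

definition indirect :: "(node \<Rightarrow> real) \<Rightarrow> node \<Rightarrow> bool" where
  "indirect u v \<longleftrightarrow> v \<in> inner d h \<and> u v < b v"

definition top_indirect :: "(node \<Rightarrow> real) \<Rightarrow> node \<Rightarrow> bool" where
  "top_indirect u v \<longleftrightarrow> indirect u v \<and> (\<forall>c. indirect u c \<longrightarrow> v \<in> visible d h u w c \<longrightarrow> c = v)"

lemma snapped_nonneg: "snapped u \<Longrightarrow> 0 \<le> u x"
  using valid[of x] by (cases "x \<in> inner d h") (auto simp: snapped_def)

lemma snapped_nonfull: "snapped u \<Longrightarrow> x \<in> inner d h \<Longrightarrow> u x + w x < 1 \<Longrightarrow> u x \<le> b x"
  using valid[of x] by (cases "x \<in> inner d h") (auto simp: snapped_def)

lemma snapped_full: "snapped u \<Longrightarrow> x \<in> inner d h \<Longrightarrow> 1 \<le> u x + w x \<Longrightarrow> u x = 1 - w x"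
  using valid[of x] by (cases "x \<in> inner d h") (auto simp: snapped_def)

lemma indirect_below:
  assumes "blocks d h u (b, w)" "indirect u v"
  shows "v \<in> inner d h" "u v + w v < 1" "hidden_below d h u w v" "hidden d h u w v"
  using assms valid[of v] by (auto simp: blocks_def indirect_def hidden_iff)

text \<open>An indirect node outside the region of \<open>v\<close> does not rely on full nodes
  inside it: if the two regions met, \<open>v\<close> would be visible from that node, contrary to
  the maximality of \<open>v\<close>.\<close>

lemma blocks_replace:
  assumes "blocks d h u (b, w)" "top_indirect u v"
    and "\<And>x. x \<notin> visible d h u w v \<Longrightarrow> u' x = u x"
    and "\<And>x. x \<in> visible d h u w v \<Longrightarrow> b x \<le> u' x \<or> hidden_below d h u' w x"
  shows "blocks d h u' (b, w)"
  unfolding blocks_def fst_conv snd_conv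
proof
  fix y assume y: "y \<in> inner d h"
  show "b y \<le> u' y \<or> hidden_below d h u' w y"
  proof (cases "y \<in> visible d h u w v")
    case True
    then show ?thesis
      using assms(4) by blast
  next
    case out: False
    show ?thesis
    proof (cases "b y \<le> u y")
      case True
      then show ?thesis
        using assms(3)[OF out] by simp
    next
      case False
      then have ind: "indirect u y"
        using y by (simp add: indirect_def)
      have v: "v \<in> inner d h"
        using assms(2) by (simp add: top_indirect_def indirect_def)
      have "hidden_below d h u' w y"
      proof (rule hidden_below_mono[where u=u and w=w])
        fix x assume x: "x \<in> visible d h u w y" "1 \<le> u x + w x"
        have "x \<notin> visible d h u w v"
        proof
          assume "x \<in> visible d h u w v"
          then have "v \<in> visible d h u w y"
            using visible_comparable[OF x(1)] out by blast
          then have "y = v"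
            using assms(2) ind by (auto simp: top_indirect_def)
          then show False
            using out visible_self[OF v] by blast
        qed
        then show "hidden d h u' w x"
          using x(2) assms(3) by (simp add: hidden.full)
      qed (use indirect_below[OF assms(1) ind] in auto)
      then show ?thesis ..
    qed
  qed
qed

text \<open>After the change, no visible node of depth \<open>m\<close> is left non-full. Together
  with the old full nodes above, these form a cut for everything above \<open>m\<close>, whereas
  nodes below \<open>m\<close> are paid for by their own weight.\<close>

lemma blocks_cut:
  assumes "blocks d h u (b, w)" "top_indirect u v"
    and "\<And>x. u' x = (if x \<in> visible d h u w v then
        (if length x < m then u x else if length x = m then (if u x + w x < 1 then 1 - w x else u x) else b x)
        else u x)"
  shows "blocks d h u' (b, w)"
proof (rule blocks_replace[OF assms(1,2)])
  show "u' x = u x" if "x \<notin> visible d h u w v" for x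
    using that assms(3) by simp
next
  fix x assume x: "x \<in> visible d h u w v"
  then have inner: "x \<in> inner d h"
    using visible_inner by blast
  have hid: "hidden d h u' w z" if "hidden d h u w z" "z \<in> inner d h" "z \<in> visible d h u w v" "length z \<le> m" for z
    using that
  proof (induction rule: hidden_induct)
    case (full z)
    then have "u' z = u z"
      using assms(3)[of z] by auto
    then show ?case
      using full by (simp add: hidden.full)
  next
    case (below z)
    show ?case
    proof (cases "length z = m")
      case True
      then have "u' z = 1 - w z"
        using assms(3)[of z] below by simp
      then show ?thesis
        by (simp add: hidden.full)
    next
      case False
      then show ?thesis
        using below visible_child[where u=u and w=w, OF below.prems(1) below(2,3)]
        by (intro hidden.below[of z]) auto
    qed
  qed
  consider "m \<le> length x" | "length x < m" "b x \<le> u x" | "length x < m" "indirect u x"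
    using inner by (force simp: indirect_def)
  then show "b x \<le> u' x \<or> hidden_below d h u' w x"
  proof cases
    case 1
    then show ?thesis
      using assms(3)[of x] x valid[OF inner] by auto
  next
    case 2
    then show ?thesis
      using assms(3)[of x] x by auto
  next
    case 3
    note ind = indirect_below[OF assms(1) 3(2)]
    have l: "length x + 3 \<le> h"
      using ind(3) by (simp add: hidden_below_def)
    have "hidden d h u' w (x @ [k])" if "k < d" for k
      using hid[of "x @ [k]"] that ind(3) 3(1) child_inner[OF inner l that] visible_child[where u=u and w=w, OF x ind(2) l that]
      by (auto simp: hidden_below_def)
    then show ?thesis
      using l by (simp add: hidden_below_def)
  qed
qed

text \<open>\<open>P\<close> and \<open>P + E\<close> are the level terms at depths \<open>n\<close>
  and \<open>m\<close>; \<open>N\<close> and \<open>N + D\<close> are the weights down to depth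
  \<open>m\<close> before and after the replacement by black values. \<open>S\<close> and
  \<open>W\<close> are the weight and the white value on the \<open>a\<close> full nodes below
  \<open>m\<close>, and \<open>q\<close> counts the nodes to be raised at \<open>m\<close>. The
  first two hypotheses give \<open>2 * S < E + 2 * D\<close>, hence \<open>2 * W < E\<close>, and so
  \<open>2 * S = 2 * a - 2 * W > 2 * (E + q) - E\<close>.\<close>

lemma exchange_arith:
  fixes K :: real
  assumes "K < P + E + 2 * (N + D)" "P + 2 * (N + S) \<le> K" "E + q \<le> a" "W + D < S" "S = a - W"
  shows "2 * q + E < 2 * S"
  using assms by argo

lemma exchange_arith2:
  fixes K :: real
  assumes "N' \<le> N + q" "2 * q + E < 2 * S" "P + 2 * (N + S) \<le> K"
  shows "P + E + 2 * N' < K"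
  using assms by argo

text \<open>
  If \<open>u\<close> outweighs the pebbles in the region below \<open>v\<close>, replace it there by the black values. Should
  this exceed the budget, let \<open>m\<close> be the greatest depth at which it does: keeping \<open>u\<close> above \<open>m\<close>
  and raising the region to full nodes at \<open>m\<close> is then even lighter, and within the budget because
  the full nodes below \<open>m\<close> outnumber the raised ones.
\<close>

lemma exchange:
  assumes u: "blocks d h u (b, w)" "within_budget d h K u" "snapped u" and v: "top_indirect u v"
    and unpaid: "(\<Sum>x\<in>visible d h u w v. b x + w x) < (\<Sum>x\<in>visible d h u w v. u x)"
  shows "\<exists>u'. blocks d h u' (b, w) \<and> within_budget d h K u' \<and> snapped u' \<and>
    sum u' (inner d h) < sum u (inner d h)"
proof -
  define R where "R = visible d h u w v"
  have R: "R \<subseteq> inner d h" "finite R"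
    using visible_inner by (auto simp: R_def)
  have vi: "v \<in> inner d h" and hid: "hidden d h u w v"
    using indirect_below[OF u(1)] v by (auto simp: top_indirect_def)
  have nn: "0 \<le> u x" for x
    using u(3) by (rule snapped_nonneg)
  let ?N = "upper_sum d h"
  define u1 where "u1 x = (if x \<in> R then b x else u x)" for x
  have b1: "blocks d h u1 (b, w)"
    using u(1) v by (rule blocks_replace) (auto simp: u1_def R_def)
  have s1: "snapped u1"
    using u(3) R(1) by (auto simp: snapped_def u1_def)
  have nn1: "0 \<le> u1 x" for x
    using s1 by (rule snapped_nonneg)
  have N1: "?N u1 n = ?N u n + (\<Sum>x | x \<in> R \<and> length x \<le> n. b x - u x)" for n
  proof -
    have "?N u1 n = ?N u n + (\<Sum>x | x \<in> R \<and> length x \<le> n. u1 x - u x)"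
      by (rule upper_sum_diff[OF R(1)]) (simp add: u1_def)
    also have "(\<Sum>x | x \<in> R \<and> length x \<le> n. u1 x - u x) = (\<Sum>x | x \<in> R \<and> length x \<le> n. b x - u x)"
      by (intro sum.cong) (auto simp: u1_def)
    finally show ?thesis .
  qed
  have "(\<Sum>x\<in>R. b x) \<le> (\<Sum>x\<in>R. b x + w x)"
    using valid R(1) by (intro sum_mono) auto
  then have "(\<Sum>x\<in>R. b x - u x) < 0"
    using unpaid unfolding R_def by (simp add: sum_subtractf)
  moreover have "{x. x \<in> R \<and> length x \<le> h} = R"
    using R(1) by (auto simp: inner_def)
  ultimately have less1: "?N u1 h < ?N u h"
    using N1[of h] by simp
  show ?thesis
  proof (cases "within_budget d h K u1")
    case True
    then show ?thesis
      using b1 s1 less1 by (auto simp: upper_sum_all)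
  next
    case False
    define bad where "bad n \<longleftrightarrow> n + 2 \<le> h \<and> 0 < ?N u1 n \<and> K < (real d - 1) * (real h - real n) + 2 * ?N u1 n" for n
    define m where "m = Max {n. bad n}"
    have "{n. bad n} \<subseteq> {..h}"
      by (auto simp: bad_def)
    then have fin: "finite {n. bad n}"
      using finite_subset by blast
    have "\<exists>n. bad n"
      using False by (auto simp: within_budget_def bad_def not_le)
    then have m: "bad m" and m_max: "\<And>n. bad n \<Longrightarrow> n \<le> m"
      using Max_in[OF fin] Max_ge[OF fin] by (auto simp: m_def)
    define D where "D = (\<Sum>x | x \<in> R \<and> length x \<le> m. b x - u x)"
    have N1m: "?N u1 m = ?N u m + D"
      by (simp add: N1 D_def)
    have D: "0 < D"
    proof (rule ccontr)
      assume "\<not> 0 < D"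
      then have "?N u1 m \<le> ?N u m"
        by (simp add: N1m)
      then show False
        using m u(2) unfolding bad_def within_budget_def by fastforce
    qed
    have "length v \<le> m"
    proof (rule ccontr)
      assume "\<not> length v \<le> m"
      then have "{x. x \<in> R \<and> length x \<le> m} = {}"
        using visible_length by (fastforce simp: R_def)
      then have "D = 0"
        unfolding D_def by (simp only: sum.empty)
      then show False
        using D by simp
    qed
    define A where "A = {x \<in> R. 1 \<le> u x + w x \<and> m < length x}"
    define Q where "Q = {x \<in> R. u x + w x < 1 \<and> length x = m}"
    define I where "I = {x \<in> R. u x + w x < 1 \<and> m < length x}"
    define S where "S = sum u A"
    have finA: "finite A" "finite Q" "finite I"
      using R(2) by (auto simp: A_def Q_def I_def)
    have "S = (\<Sum>x\<in>A. 1 - w x)"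
      unfolding S_def using R(1) snapped_full[OF u(3)] by (intro sum.cong) (auto simp: A_def)
    then have S_card: "S = real (card A) - sum w A"
      by (simp add: sum_subtractf)
    \<comment> \<open>In the region, \<open>u - b - w\<close> has a positive sum. Depths up to
      \<open>m\<close> contribute at most \<open>- D\<close>, and non-full nodes below
      \<open>m\<close> at most 0 because a snapped weight there does not exceed \<open>b\<close>.
      The full nodes below \<open>m\<close> must make up for this.\<close>
    have S_gt: "sum w A + D < S"
    proof -
      have split: "sum f R = (\<Sum>x | x \<in> R \<and> length x \<le> m. f x) + sum f A + sum f I" for f :: "node \<Rightarrow> real"
      proof -
        have "R = {x \<in> R. length x \<le> m} \<union> (A \<union> I)"
          by (auto simp: A_def I_def)
        then have "sum f R = sum f ({x \<in> R. length x \<le> m} \<union> (A \<union> I))"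
          by simp
        also have "\<dots> = sum f {x \<in> R. length x \<le> m} + sum f (A \<union> I)"
          using R(2) finA by (intro sum.union_disjoint) (auto simp: A_def I_def)
        also have "sum f (A \<union> I) = sum f A + sum f I"
          using finA by (intro sum.union_disjoint) (auto simp: A_def I_def)
        finally show ?thesis
          by simp
      qed
      have "(\<Sum>x\<in>R. u x - b x - w x) > 0"
        using unpaid by (simp add: R_def sum_subtractf sum.distrib)
      then have "0 < (\<Sum>x | x \<in> R \<and> length x \<le> m. u x - b x - w x) + (\<Sum>x\<in>A. u x - b x - w x) + (\<Sum>x\<in>I. u x - b x - w x)"
        unfolding split .
      moreover have "(\<Sum>x | x \<in> R \<and> length x \<le> m. u x - b x - w x) \<le> - D"
        unfolding D_def sum_negf[symmetric] using valid R(1) by (intro sum_mono) auto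
      moreover have "(\<Sum>x\<in>A. u x - b x - w x) \<le> S - sum w A"
        unfolding S_def sum_subtractf[symmetric] using valid R(1) by (intro sum_mono) (auto simp: A_def)
      moreover have "(\<Sum>x\<in>I. u x - b x - w x) \<le> 0"
        using valid R(1) snapped_nonfull[OF u(3)] by (intro sum_nonpos) (fastforce simp: I_def)
      ultimately show ?thesis
        by linarith
    qed
    have "0 \<le> sum w A"
      using valid R(1) by (intro sum_nonneg) (auto simp: A_def)
    then have "0 < S"
      using S_gt D by linarith
    \<comment> \<open>The smallest depth at which the budget of \<open>u\<close> accounts for all of
      \<open>S\<close>; full nodes of weight 0 do not matter.\<close>
    define n where "n = Max (length ` {x \<in> A. 0 < u x})"
    have ne: "{x \<in> A. 0 < u x} \<noteq> {}"
      using \<open>0 < S\<close> sum_nonpos[of A u] unfolding S_def by (force simp: not_less)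
    have "n \<in> length ` {x \<in> A. 0 < u x}"
      unfolding n_def using finA ne by (intro Max_in) auto
    then obtain x where x: "x \<in> A" "0 < u x" "length x = n"
      by auto
    have n_max: "length y \<le> n" if "y \<in> A" "0 < u y" for y
      unfolding n_def using that finA by (intro Max_ge) auto
    have n: "m < n" "n + 2 \<le> h"
      using x R(1) by (auto simp: A_def inner_def)
    have Nn: "?N u m + S \<le> ?N u n"
    proof -
      have "S = sum u {y \<in> A. 0 < u y}"
        unfolding S_def using finA nn by (intro sum.mono_neutral_right) (auto simp: not_less order.antisym)
      then have "?N u m + S = sum u ({y \<in> inner d h. length y \<le> m} \<union> {y \<in> A. 0 < u y})"
        unfolding upper_sum_def using R(2) by (subst sum.union_disjoint) (auto simp: A_def)
      also have "\<dots> \<le> ?N u n"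
        unfolding upper_sum_def using nn n_max n(1) R(1)
        by (intro sum_mono2) (auto simp: A_def)
      finally show ?thesis .
    qed
    have Nm_nn: "0 \<le> ?N u m"
      using nn by (intro upper_sum_nonneg)
    have budget: "(real d - 1) * (real h - real n) + 2 * ?N u n \<le> K"
      using u(2) n Nn Nm_nn \<open>0 < S\<close> by (auto simp: within_budget_def)
    have "(d - 1) * (n - m) + card Q \<le> card A"
      using card_full_below_ge[OF hid vi d, of x m] x \<open>length v \<le> m\<close> by (simp add: A_def Q_def R_def)
    then have "real ((d - 1) * (n - m) + card Q) \<le> real (card A)"
      by (simp only: of_nat_le_iff)
    then have count: "(real d - 1) * (real n - real m) + real (card Q) \<le> real (card A)"
      using d n(1) by (simp add: of_nat_diff)
    define E where "E = (real d - 1) * (real n - real m)"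
    have E: "(real d - 1) * (real h - real m) = (real d - 1) * (real h - real n) + E"
      by (simp add: E_def algebra_simps)
    have viol: "K < (real d - 1) * (real h - real m) + 2 * (?N u m + D)"
      using m by (simp add: bad_def N1m)
    define P where "P = (real d - 1) * (real h - real n)"
    have "K < P + E + 2 * (?N u m + D)" "P + 2 * ?N u n \<le> K" "E + real (card Q) \<le> real (card A)"
      using viol budget count unfolding E by (simp_all add: P_def E_def)
    note bnd = this
    have key2: "P + 2 * (?N u m + S) \<le> K"
      using bnd(2) Nn by simp
    have key: "2 * real (card Q) + E < 2 * S"
      by (rule exchange_arith[OF bnd(1) key2 bnd(3) S_gt S_card])
    define u2 where "u2 x = (if x \<in> visible d h u w v then
        (if length x < m then u x else if length x = m then (if u x + w x < 1 then 1 - w x else u x) else b x)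
        else u x)" for x
    have b2: "blocks d h u2 (b, w)"
      using u(1) v u2_def by (rule blocks_cut)
    have s2: "snapped u2"
      using u(3) R(1) by (auto simp: snapped_def u2_def R_def)
    have N2m: "?N u2 m \<le> ?N u m + real (card Q)"
    proof -
      have "?N u2 m = ?N u m + (\<Sum>x | x \<in> R \<and> length x \<le> m. u2 x - u x)"
        by (rule upper_sum_diff[OF R(1)]) (simp add: u2_def R_def)
      also have "(\<Sum>x | x \<in> R \<and> length x \<le> m. u2 x - u x) = (\<Sum>x\<in>Q. u2 x - u x)"
        using R(2) by (intro sum.mono_neutral_right) (auto simp: Q_def u2_def)
      also have "\<dots> \<le> (\<Sum>x\<in>Q. 1)"
      proof (rule sum_mono)
        fix x assume "x \<in> Q"
        then have "u2 x = 1 - w x" "x \<in> inner d h"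
          using R(1) by (auto simp: Q_def u2_def R_def)
        then show "u2 x - u x \<le> 1"
          using valid[of x] nn[of x] by simp
      qed
      finally show ?thesis
        by simp
    qed
    have N2_lt: "?N u2 n' = ?N u n'" if "n' < m" for n'
      unfolding upper_sum_def using that by (intro sum.cong) (auto simp: u2_def)
    have N2m_budget: "(real d - 1) * (real h - real m) + 2 * ?N u2 m < K"
      using exchange_arith2[OF N2m key key2] by (simp add: E P_def)
    have N2m_less: "?N u2 m < ?N u1 m"
      using N2m_budget viol N1m by argo
    have N2_less: "?N u2 n' < ?N u1 n'" if "m \<le> n'" for n'
    proof -
      have "?N u' n' = ?N u' m + (\<Sum>x | x \<in> inner d h \<and> m < length x \<and> length x \<le> n'. u' x)" for u'
      proof -
        have "{x \<in> inner d h. length x \<le> n'} =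
            {x \<in> inner d h. length x \<le> m} \<union> {x \<in> inner d h. m < length x \<and> length x \<le> n'}"
          using that by auto
        then show ?thesis
          unfolding upper_sum_def by (simp add: sum.union_disjoint disjoint_iff)
      qed
      moreover have "(\<Sum>x | x \<in> inner d h \<and> m < length x \<and> length x \<le> n'. u2 x) =
          (\<Sum>x | x \<in> inner d h \<and> m < length x \<and> length x \<le> n'. u1 x)"
        by (intro sum.cong) (auto simp: u1_def u2_def R_def)
      ultimately show ?thesis
        using N2m_less by simp
    qed
    have "within_budget d h K u2"
      unfolding within_budget_def
    proof (intro allI impI)
      fix n' assume n': "n' + 2 \<le> h" "0 < ?N u2 n'"
      consider "n' < m" | "n' = m" | "m < n'"
        by linarith
      then show "(real d - 1) * (real h - real n') + 2 * ?N u2 n' \<le> K"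
      proof cases
        case 1
        then show ?thesis
          using u(2) n' N2_lt by (simp add: within_budget_def)
      next
        case 2
        then show ?thesis
          using N2m_budget by simp
      next
        \<comment> \<open>Beyond \<open>m\<close> the black replacement \<open>u1\<close> already
          respects the budget by the choice of \<open>m\<close>, and \<open>u2\<close> is lighter
          still.\<close>
        case 3
        then have "\<not> bad n'" "?N u2 n' < ?N u1 n'"
          using m_max[of n'] N2_less[of n'] by auto
        then show ?thesis
          using n' by (auto simp: bad_def)
      qed
    qed
    moreover have "?N u2 h < ?N u h"
      using N2_less[of h] less1 n by simp
    ultimately show ?thesis
      using b2 s2 by (auto simp: upper_sum_all)
  qed
qed

text \<open>Weight in excess of the black value serves only to hide an indirect node that sees it.
  Without such a node it could be lowered, against minimality.\<close>

lemma visible_indirect: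
  assumes u: "blocks d h u (b, w)" "within_budget d h K u" "snapped u"
    and min: "\<And>u'. blocks d h u' (b, w) \<Longrightarrow> within_budget d h K u' \<Longrightarrow> snapped u' \<Longrightarrow>
      sum u (inner d h) \<le> sum u' (inner d h)"
    and x: "x \<in> inner d h" "b x < u x"
  shows "\<exists>c. indirect u c \<and> x \<in> visible d h u w c"
proof (rule ccontr)
  assume no: "\<nexists>c. indirect u c \<and> x \<in> visible d h u w c"
  define u' where "u' = u(x := b x)"
  have "blocks d h u' (b, w)"
    unfolding blocks_def fst_conv snd_conv
  proof
    fix y assume y: "y \<in> inner d h"
    show "b y \<le> u' y \<or> hidden_below d h u' w y"
    proof (cases "indirect u y")
      case True
      note ind = indirect_below[OF u(1) True]
      have "hidden_below d h u' w y"
      proof (rule hidden_below_mono[OF ind(3,1,2)])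
        fix z assume "z \<in> visible d h u w y" "1 \<le> u z + w z"
        then show "hidden d h u' w z"
          using no True by (intro hidden.full) (auto simp: u'_def)
      qed
      then show ?thesis ..
    next
      case False
      then show ?thesis
        using y by (auto simp: indirect_def u'_def)
    qed
  qed
  moreover have "within_budget d h K u'"
    using u(2) by (rule within_budget_antimono) (use x in \<open>auto simp: u'_def\<close>)
  moreover have "snapped u'"
    using u(3) x by (auto simp: snapped_def u'_def)
  ultimately have "sum u (inner d h) \<le> sum u' (inner d h)"
    by (rule min)
  moreover have "sum u' (inner d h) < sum u (inner d h)"
    by (rule sum_strict_mono_ex1) (use x in \<open>auto simp: u'_def\<close>)
  ultimately show False
    by simp
qed

lemma visible_top_indirect:
  assumes "indirect u c" "x \<in> visible d h u w c"
  shows "\<exists>v. top_indirect u v \<and> x \<in> visible d h u w v"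
proof -
  define P where "P v \<longleftrightarrow> indirect u v \<and> x \<in> visible d h u w v" for v
  obtain v where v: "P v" "\<And>c. P c \<Longrightarrow> length v \<le> length c"
    using ex_has_least_nat[of P c length] assms unfolding P_def by blast
  have "c = v" if "indirect u c" "v \<in> visible d h u w c" for c
  proof -
    have "P c"
      using that v(1) visible_trans[OF that(2)] by (simp add: P_def)
    then have "length v \<le> length c" "prefix c v"
      using v(2) that(2) by (auto simp: visible_def)
    then show ?thesis
      by (auto simp: prefix_def)
  qed
  then show ?thesis
    using v(1) by (auto simp: top_indirect_def P_def)
qed

text \<open>Outside the disjoint regions of the top indirect nodes, \<open>u\<close> is at most
  \<open>b\<close>. An excess of \<open>u\<close> over all pebbles must therefore occur within one
  of the regions.\<close>

lemma unpaid_top_indirect: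
  assumes u: "blocks d h u (b, w)" "within_budget d h K u" "snapped u"
    and min: "\<And>u'. blocks d h u' (b, w) \<Longrightarrow> within_budget d h K u' \<Longrightarrow> snapped u' \<Longrightarrow>
      sum u (inner d h) \<le> sum u' (inner d h)"
    and unpaid: "(\<Sum>x\<in>inner d h. b x + w x) < sum u (inner d h)"
  shows "\<exists>v. top_indirect u v \<and>
    (\<Sum>x\<in>visible d h u w v. b x + w x) < (\<Sum>x\<in>visible d h u w v. u x)"
proof (rule ccontr)
  assume no: "\<not> ?thesis"
  define V where "V = {v. top_indirect u v}"
  define f where "f x = u x - (b x + w x)" for x
  let ?R = "visible d h u w"
  have V: "finite V"
    by (rule finite_subset[of _ "inner d h"]) (auto simp: V_def top_indirect_def indirect_def)
  have "sum f (inner d h) = sum f (\<Union>v\<in>V. ?R v) + sum f (inner d h - (\<Union>v\<in>V. ?R v))"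
    using sum.subset_diff[of "\<Union>v\<in>V. ?R v" "inner d h" f]
      UN_least[of V ?R "inner d h", OF visible_inner] by simp
  also have "sum f (\<Union>v\<in>V. ?R v) = (\<Sum>v\<in>V. sum f (?R v))"
  proof (rule sum.UNION_disjoint)
    show "\<forall>i\<in>V. \<forall>j\<in>V. i \<noteq> j \<longrightarrow> ?R i \<inter> ?R j = {}"
    proof (intro ballI impI)
      fix i j assume "i \<in> V" "j \<in> V" "i \<noteq> j"
      then show "?R i \<inter> ?R j = {}"
        using visible_comparable[of _ d h u w i j] unfolding V_def top_indirect_def by blast
    qed
  qed (use V in auto)
  also have "\<dots> \<le> 0"
  proof (rule sum_nonpos)
    fix v assume "v \<in> V"
    then show "sum f (?R v) \<le> 0"
      using no by (auto simp: V_def f_def sum_subtractf not_less)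
  qed
  also have "sum f (inner d h - (\<Union>v\<in>V. ?R v)) \<le> 0"
  proof (rule sum_nonpos)
    fix x assume x: "x \<in> inner d h - (\<Union>v\<in>V. ?R v)"
    have "u x \<le> b x"
    proof (rule ccontr)
      assume "\<not> u x \<le> b x"
      then obtain c where "indirect u c" "x \<in> ?R c"
        using visible_indirect[OF u min] x by (meson DiffD1 not_le)
      then show False
        using visible_top_indirect x by (auto simp: V_def)
    qed
    then show "f x \<le> 0"
      using valid[of x] x by (simp add: f_def)
  qed
  finally have "sum f (inner d h) \<le> 0"
    by simp
  then show False
    using unpaid by (simp add: f_def sum_subtractf)
qed

lemma snap:
  assumes "blocks d h u (b, w)" "within_budget d h K u" "\<And>x. 0 \<le> u x"
  shows "\<exists>u'. blocks d h u' (b, w) \<and> within_budget d h K u' \<and> snapped u'"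
proof -
  define u' where "u' x = (if x \<notin> inner d h then 0 else if 1 - w x \<le> u x then 1 - w x
    else if b x \<le> u x then b x else 0)" for x
  have hid: "hidden d h u' w v" if "hidden d h u w v" "v \<in> inner d h" for v
  proof (rule hidden_mono[OF that])
    fix x assume "x \<in> visible d h u w v" "1 \<le> u x + w x"
    then have "1 \<le> u' x + w x"
      using visible_inner[of d h u w v] by (auto simp: u'_def)
    then show "hidden d h u' w x"
      by (rule hidden.full)
  qed
  have "blocks d h u' (b, w)"
    unfolding blocks_def fst_conv snd_conv
  proof
    fix v assume v: "v \<in> inner d h"
    have "b v \<le> u' v" if "b v \<le> u v"
      using that valid[OF v] v by (auto simp: u'_def)
    moreover have "hidden_below d h u' w v" if "hidden_below d h u w v"
      using that hid child_inner[OF v] by (auto simp: hidden_below_def)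
    ultimately show "b v \<le> u' v \<or> hidden_below d h u' w v"
      using assms(1) v by (auto simp: blocks_def)
  qed
  moreover have "within_budget d h K u'"
    using assms(2) by (rule within_budget_antimono) (use assms(3) in \<open>auto simp: u'_def\<close>)
  moreover have "snapped u'"
    by (auto simp: snapped_def u'_def)
  ultimately show ?thesis
    by blast
qed

lemma finite_snapped: "finite {u. snapped u}"
proof -
  let ?B = "{0} \<union> b ` inner d h \<union> (\<lambda>x. 1 - w x) ` inner d h"
  have "{u. snapped u} \<subseteq>
      {u. \<forall>x. (x \<in> inner d h \<longrightarrow> u x \<in> ?B) \<and> (x \<notin> inner d h \<longrightarrow> u x = 0)}"
    by (auto simp: snapped_def)
  moreover have "finite \<dots>"
    by (rule finite_set_of_finite_funs) auto
  ultimately show ?thesis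
    by (rule finite_subset)
qed

text \<open>A snapped weighting of least total weight works: if it outweighed the pebbles, it would
  have an unpaid region, and \<open>exchange\<close> would yield a lighter one.\<close>

lemma blocking_small:
  assumes "blocks d h u (b, w)" "within_budget d h K u" "\<And>x. 0 \<le> u x"
  shows "\<exists>u'. blocks d h u' (b, w) \<and> within_budget d h K u' \<and> (\<forall>x. 0 \<le> u' x) \<and>
    sum u' (inner d h) \<le> (\<Sum>x\<in>inner d h. b x + w x)"
proof -
  define S where "S = {u. blocks d h u (b, w) \<and> within_budget d h K u \<and> snapped u}"
  have "finite S"
    by (rule finite_subset[OF _ finite_snapped]) (auto simp: S_def)
  moreover have "S \<noteq> {}"
    using snap[OF assms] by (auto simp: S_def)
  ultimately obtain u' where "is_arg_min (\<lambda>u. sum u (inner d h)) (\<lambda>u. u \<in> S) u'"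
    using ex_is_arg_min_if_finite by blast
  then have u': "u' \<in> S" and min: "\<And>u. u \<in> S \<Longrightarrow> sum u' (inner d h) \<le> sum u (inner d h)"
    by (auto simp: is_arg_min_linorder)
  have "sum u' (inner d h) \<le> (\<Sum>x\<in>inner d h. b x + w x)"
  proof (rule ccontr)
    assume "\<not> ?thesis"
    then obtain v where "top_indirect u' v"
        "(\<Sum>x\<in>visible d h u' w v. b x + w x) < (\<Sum>x\<in>visible d h u' w v. u' x)"
      using unpaid_top_indirect[of u' K] u' min by (auto simp: S_def)
    then obtain u'' where "u'' \<in> S" "sum u'' (inner d h) < sum u' (inner d h)"
      using exchange[of u' K v] u' by (auto simp: S_def)
    then show False
      using min by fastforce
  qed
  then show ?thesis
    using u' snapped_nonneg by (auto simp: S_def)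
qed

end

section \<open>Lower bounds\<close>

lemma inner_subset_tree: "inner d h \<subseteq> balanced_tree d h"
  by (auto simp: inner_def balanced_tree_def)

lemma finite_balanced_tree [simp]: "finite (balanced_tree d h)"
proof (rule finite_subset)
  show "balanced_tree d h \<subseteq> {v. set v \<subseteq> {..<d} \<and> length v \<le> h}"
    by (auto simp: balanced_tree_def)
qed (simp add: finite_lists_length_le)

lemma inner_iff: "v \<in> balanced_tree d h \<Longrightarrow> v \<in> inner d h \<longleftrightarrow> length v + 2 \<le> h"
  by (auto simp: inner_def balanced_tree_def)

lemma children_inner:
  "v \<in> inner d h \<Longrightarrow> children (balanced_tree d h) v = (\<lambda>k. v @ [k]) ` {..<d}"
  using children_balanced_tree[of v d h] inner_subset_tree by (auto simp: inner_def)

lemma card_children_image: "card ((\<lambda>k. v @ [k]) ` {..<d}) = d"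
  by (simp add: card_image inj_on_def)

lemma pebbled_weight:
  assumes "admissible (balanced_tree d h) p c" "relaxed_step (balanced_tree d h) (Some i) c c'"
    and "length i + 2 = h"
  shows "(\<Sum>x\<in>inner d h. fst c x + snd c x) + real d \<le> p"
proof -
  let ?T = "balanced_tree d h" and ?C = "(\<lambda>k. i @ [k]) ` {..<d}"
  have i: "i \<in> inner d h"
    using relaxed_stepD(3)[OF assms(2) refl] assms(3) by (simp add: inner_iff)
  have C: "?C \<subseteq> ?T"
    using i assms(3) by (auto simp: inner_def balanced_tree_def)
  have disj: "inner d h \<inter> ?C = {}"
    using assms(3) by (auto simp: inner_def)
  have "(\<Sum>x\<in>?C. fst c x + snd c x) = (\<Sum>x\<in>?C. 1)"
    using relaxed_stepD(4)[OF assms(2) refl] children_inner[OF i] by (intro sum.cong) auto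
  then have "(\<Sum>x\<in>inner d h. fst c x + snd c x) + real d = (\<Sum>x\<in>inner d h \<union> ?C. fst c x + snd c x)"
    using disj by (subst sum.union_disjoint) (auto simp: card_children_image)
  also have "\<dots> \<le> (\<Sum>x\<in>?T. fst c x + snd c x)"
    using C inner_subset_tree assms(1)
    by (intro sum_mono2) (auto simp: admissible_def valid_config_iff)
  also have "\<dots> \<le> p"
    using assms(1) by (simp add: admissible_def num_pebbles_eq)
  finally show ?thesis .
qed

section \<open>The budget along a pebbling\<close>

definition blocked :: "nat \<Rightarrow> nat \<Rightarrow> real \<Rightarrow> config \<Rightarrow> bool" where
  "blocked d h K c \<longleftrightarrow> (\<exists>u. (\<forall>x. 0 \<le> u x) \<and> blocks d h u c \<and> within_budget d h K u)"

lemma blocks_step: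
  assumes "blocks d h u c"
    and "\<And>v. v \<in> inner d h \<Longrightarrow> hidden d h u (snd c) v \<Longrightarrow> hidden d h u' (snd c') v"
    and "\<And>v. v \<in> inner d h \<Longrightarrow> fst c' v \<le> fst c v \<and> u v \<le> u' v \<or> fst c' v \<le> u' v \<or> hidden_below d h u' (snd c') v"
  shows "blocks d h u' c'"
  unfolding blocks_def
proof
  fix v assume v: "v \<in> inner d h"
  have "hidden_below d h u' (snd c') v" if "hidden_below d h u (snd c) v"
    using that assms(2) child_inner[OF v] by (auto simp: hidden_below_def)
  then show "fst c' v \<le> u' v \<or> hidden_below d h u' (snd c') v"
    using assms(1,3) v by (force simp: blocks_def)
qed

lemma blocked_step:
  assumes d: "1 \<le> d" and step: "admissible (balanced_tree d h) p c" "admissible (balanced_tree d h) p c'"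
    "relaxed_step (balanced_tree d h) l c c'"
    and bl: "blocked d h (2 * p) c"
  shows "blocked d h (2 * p) c'"
proof -
  note inT = subsetD[OF inner_subset_tree]
  have mono: "fst c' v \<le> fst c v" "snd c v \<le> snd c' v" if "v \<in> inner d h" "l \<noteq> Some v" for v
    using relaxed_stepD(1,2)[OF step(3) inT[OF that(1)] that(2)] by auto
  have valid: "0 \<le> fst c v \<and> 0 \<le> snd c v \<and> fst c v + snd c v \<le> 1"
    "0 \<le> fst c' v \<and> 0 \<le> snd c' v \<and> fst c' v + snd c' v \<le> 1" if "v \<in> inner d h" for v
    using step(1,2) inT[OF that] by (auto simp: admissible_def valid_config_iff)
  obtain u where u: "\<And>x. 0 \<le> u x" "blocks d h u c" "within_budget d h (2 * p) u"
    using bl by (auto simp: blocked_def)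
  \<comment> \<open>Away from the pebbled node white values only rise, so full nodes stay full. Only
    the pebbled node itself may stop being full and has to be hidden anew.\<close>
  have keep: "hidden d h u' (snd c') v"
    if "hidden d h u (snd c) v" "v \<in> inner d h"
      "\<And>i. l = Some i \<Longrightarrow> i \<in> visible d h u (snd c) v \<Longrightarrow> hidden d h u' (snd c') i"
      "\<And>x. l \<noteq> Some x \<Longrightarrow> u x = u' x"
    for u u' v
  proof (rule hidden_mono[OF that(1,2)])
    fix x assume x: "x \<in> visible d h u (snd c) v" "1 \<le> u x + snd c x"
    then have "x \<in> inner d h"
      using visible_inner by blast
    show "hidden d h u' (snd c') x"
    proof (cases "l = Some x")
      case False
      then show ?thesis
        using x mono(2)[OF \<open>x \<in> inner d h\<close> False] that(4)[of x] by (intro hidden.full) simp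
    qed (use that(3) x in blast)
  qed
  consider (none) "\<And>i. l = Some i \<Longrightarrow> i \<notin> inner d h" | (high) i where "l = Some i" "i \<in> inner d h" "length i + 3 \<le> h"
    | (low) i where "l = Some i" "i \<in> inner d h" "length i + 2 = h"
    by (force simp: inner_def)
  then show ?thesis
  proof cases
    case none
    have "blocks d h u c'"
    proof (rule blocks_step[OF u(2)])
      show "hidden d h u (snd c') v" if "v \<in> inner d h" "hidden d h u (snd c) v" for v
        using that(2,1) by (rule keep) (use none visible_inner in blast)+
      show "fst c' v \<le> fst c v \<and> u v \<le> u v \<or> fst c' v \<le> u v \<or> hidden_below d h u (snd c') v"
        if "v \<in> inner d h" for v
        using none mono(1) that by auto
    qed
    then show ?thesis
      using u by (auto simp: blocked_def)
  next
    case high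
    have ch: "hidden d h u (snd c) (i @ [k])" if "k < d" for k
    proof -
      have ic: "i @ [k] \<in> inner d h"
        using child_inner high that by blast
      have "fst c (i @ [k]) + snd c (i @ [k]) = 1"
        using relaxed_stepD(4)[OF step(3) high(1)] that children_inner[OF high(2)] by auto
      \<comment> \<open>Either \<open>u\<close> pays for the black value, and value 1 makes the
        child full, or \<open>blocks\<close> hides the child from below.\<close>
      then show ?thesis
        using u(2) ic by (auto simp: blocks_def hidden_iff)
    qed
    have below_i: "hidden_below d h u (snd c') i"
      unfolding hidden_below_def
    proof (intro conjI allI impI high)
      fix k assume k: "k < d"
      show "hidden d h u (snd c') (i @ [k])"
      proof (rule keep[OF ch[OF k]])
        show "i @ [k] \<in> inner d h"
          using child_inner high k by blast
        show "hidden d h u (snd c') j" if "l = Some j" "j \<in> visible d h u (snd c) (i @ [k])" for j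
          using visible_length[OF that(2)] high(1) that(1) by simp
      qed simp
    qed
    have "blocks d h u c'"
    proof (rule blocks_step[OF u(2)])
      show "hidden d h u (snd c') v" if "v \<in> inner d h" "hidden d h u (snd c) v" for v
        using that(2,1) by (rule keep) (use below_i high(1) in \<open>auto simp: hidden_iff[of _ _ _ _ i]\<close>)
      show "fst c' v \<le> fst c v \<and> u v \<le> u v \<or> fst c' v \<le> u v \<or> hidden_below d h u (snd c') v"
        if "v \<in> inner d h" for v
        using below_i mono(1) that high(1) by (cases "v = i") auto
    qed
    then show ?thesis
      using u by (auto simp: blocked_def)
  next
    case low
    \<comment> \<open>This is the only case in which the weight must be compared with the pebbles
      present, so the weighting is made light first.\<close>
    have "\<exists>u1. blocks d h u1 (fst c, snd c) \<and> within_budget d h (2 * p) u1 \<and> (\<forall>x. 0 \<le> u1 x) \<and>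
        sum u1 (inner d h) \<le> (\<Sum>x\<in>inner d h. fst c x + snd c x)"
      by (rule blocking_small[OF d, where u = u]) (use u valid in auto)
    then obtain u1 where u1: "blocks d h u1 (fst c, snd c)" "within_budget d h (2 * p) u1" "\<And>x. 0 \<le> u1 x"
      "sum u1 (inner d h) \<le> (\<Sum>x\<in>inner d h. fst c x + snd c x)"
      by blast
    define u2 where "u2 = u1(i := 1)"
    have hid_i: "hidden d h u2 (snd c') i"
      using valid(2)[OF low(2)] by (intro hidden.full) (simp add: u2_def)
    have "blocks d h u2 c'"
    proof (rule blocks_step[OF u1(1)])
      show "hidden d h u2 (snd c') v" if "v \<in> inner d h" "hidden d h u1 (snd (fst c, snd c)) v" for v
        using that(2)[unfolded snd_conv] that(1) by (rule keep) (use hid_i low(1) in \<open>auto simp: u2_def\<close>)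
      show "fst c' v \<le> fst (fst c, snd c) v \<and> u1 v \<le> u2 v \<or> fst c' v \<le> u2 v \<or> hidden_below d h u2 (snd c') v"
        if "v \<in> inner d h" for v
        using mono(1) that low(1) valid(2)[OF that] by (cases "v = i") (auto simp: u2_def)
    qed
    moreover have "within_budget d h (2 * p) u2"
      unfolding within_budget_def
    proof (intro allI impI)
      fix n assume n: "n + 2 \<le> h" "0 < upper_sum d h u2 n"
      show "(real d - 1) * (real h - real n) + 2 * upper_sum d h u2 n \<le> 2 * p"
      proof (cases "n < length i")
        case True
        then have "upper_sum d h u2 n = upper_sum d h u1 n"
          unfolding upper_sum_def by (intro sum.cong) (auto simp: u2_def)
        then show ?thesis
          using u1(2) n by (simp add: within_budget_def)
      next
        case False
        \<comment> \<open>Depth \<open>n\<close> is now the deepest inner level, of height 2. A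
          smaller depth does not see the new weight at \<open>i\<close>.\<close>
        then have h: "real h - real n = 2"
          using n low by (simp flip: of_nat_diff)
        have "upper_sum d h u2 n \<le> sum u2 (inner d h)"
          unfolding upper_sum_def using u1(3) by (intro sum_mono2) (auto simp: u2_def)
        also have "\<dots> \<le> sum u1 (inner d h) + 1"
          using u1(3)[of i] low(2) by (simp add: u2_def sum.remove[of _ i])
        also have "\<dots> \<le> p - real d + 1"
          using u1(4) pebbled_weight[OF step(1) step(3)[unfolded low(1)] low(3)] by simp
        finally show ?thesis
          unfolding h by simp
      qed
    qed
    moreover have "\<forall>x. 0 \<le> u2 x"
      using u1(3) by (simp add: u2_def)
    ultimately show ?thesis
      unfolding blocked_def by blast
  qed
qed

text \<open>The zero weighting is never charged, since the level term is due only at depths with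
  positive weight.\<close>

lemma blocked_zero: "zero_config (balanced_tree d h) c \<Longrightarrow> blocked d h K c"
  unfolding blocked_def
  by (rule exI[of _ "\<lambda>x. 0"])
    (use inner_subset_tree in \<open>force simp: blocks_def zero_config_iff within_budget_def upper_sum_def\<close>)

text \<open>Without white pebbles every full node weighs at least 1. The budget is read off at the
  depth \<open>n\<close> of the deepest visible full node, where it accounts for all of
  them.\<close>

lemma blocked_root:
  assumes "1 \<le> d" "2 \<le> h" "blocked d h K c" "fst c [] = 1" "\<And>x. x \<in> inner d h \<Longrightarrow> snd c x = 0"
  shows "(real d - 1) * real h + 2 \<le> K"
proof -
  obtain u where u: "\<And>x. 0 \<le> u x" "blocks d h u c" "within_budget d h K u"
    using assms(3) by (auto simp: blocked_def)
  have root: "[] \<in> inner d h"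
    using assms(2) by (simp add: inner_def)
  then have hid: "hidden d h u (snd c) []"
    using u(2) assms(4,5) by (auto simp: blocks_def hidden_iff)
  define A where "A = {x \<in> visible d h u (snd c) []. 1 \<le> u x + snd c x}"
  have A: "finite A" "A \<subseteq> inner d h"
    using visible_inner[of d h u "snd c" "[]"] by (auto simp: A_def)
  have "A \<noteq> {}"
    using card_full_pos[OF hid root assms(1)] unfolding A_def by (metis card.empty not_one_le_zero)
  define n where "n = Max (length ` A)"
  have "n \<in> length ` A"
    unfolding n_def using A \<open>A \<noteq> {}\<close> by (intro Max_in) auto
  then obtain x where x: "x \<in> A" "length x = n"
    by auto
  have n_max: "length y \<le> n" if "y \<in> A" for y
    unfolding n_def using that A by (intro Max_ge) auto
  have "n + 2 \<le> h"
    using x A by (auto simp: inner_def)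
  have "(d - 1) * n + 1 \<le> card A"
    using card_full_ge[OF hid root assms(1), of x] x by (simp add: A_def)
  then have "real ((d - 1) * n + 1) \<le> real (card A)"
    by (simp only: of_nat_le_iff)
  then have "(real d - 1) * real n + 1 \<le> real (card A)"
    using assms(1) by (simp add: of_nat_diff)
  also have "real (card A) = (\<Sum>x\<in>A. 1)"
    by simp
  also have "\<dots> \<le> sum u A"
    using A assms(5) by (intro sum_mono) (force simp: A_def)
  also have "\<dots> \<le> upper_sum d h u n"
    unfolding upper_sum_def using A n_max u(1) by (intro sum_mono2) auto
  finally have N: "(real d - 1) * real n + 1 \<le> upper_sum d h u n" .
  have "0 \<le> (real d - 1) * real n"
    using assms(1) by simp
  then have "(real d - 1) * (real h - real n) + 2 * upper_sum d h u n \<le> K"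
    using u(3) \<open>n + 2 \<le> h\<close> N by (auto simp: within_budget_def)
  moreover have "(real d - 1) * (real h - real n) = (real d - 1) * real h - (real d - 1) * real n"
    by (rule right_diff_distrib)
  ultimately show ?thesis
    using N \<open>0 \<le> (real d - 1) * real n\<close> by simp
qed

text \<open>
  Keeping the black pebble on the root until the end costs one more pebble and turns the pebbling
  into one that ends with a black root and no white pebbles.
\<close>

lemma pebbling_lower_bound:
  assumes "1 \<le> d" "2 \<le> h" "has_pebbling (balanced_tree d h) p"
  shows "(real d - 1) * real h / 2 \<le> p"
proof -
  let ?T = "balanced_tree d h"
  obtain N c l m where sch: "schedule ?T p N c l m"
    using has_pebbling_schedule[OF assms(3)] by blast
  note sch' = scheduleD[OF sch]
  have root: "[] \<in> ?T" "[] \<in> inner d h"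
    using assms(2) by (auto simp: balanced_tree_def inner_def)
  define c' where "c' k = (if k < m then c k else ((fst (c k))([] := 1), (snd (c k))([] := 0)))" for k
  define l' where "l' k = (if k < m \<or> l k \<noteq> Some [] then l k else None)" for k
  have valid: "0 \<le> fst (c k) v" "0 \<le> snd (c k) v" "fst (c k) v + snd (c k) v \<le> 1" if "v \<in> ?T" for k v
    using sch'(1)[of k] that by (auto simp: admissible_def valid_config_iff)
  have "snd (c m) [] = 0"
    using valid[OF root(1), of m] sch'(7) by auto
  then have c'm: "c' m = c m"
    using sch'(7) by (auto simp: c'_def prod_eq_iff)
  have adm: "admissible ?T (p + 1) (c' k)" for k
  proof -
    have "num_pebbles ?T (c' k) \<le> num_pebbles ?T (c k) + 1"
      using root valid[OF root(1), of k]
      by (auto simp: c'_def num_pebbles_eq sum.remove[of _ "[]"])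
    then show ?thesis
      using sch'(1)[of k] by (auto simp: admissible_def valid_config_iff c'_def)
  qed
  have step: "relaxed_step ?T (l' k) (c' k) (c' (Suc k))" for k
  proof (cases "k < m")
    case True
    then have "c' (Suc k) = c (Suc k)"
      using c'm by (cases "Suc k = m") (auto simp: c'_def)
    then show ?thesis
      using sch'(2)[of k] True by (simp add: c'_def l'_def)
  next
    case False
    have ne: "u \<noteq> []" if "u \<in> children ?T v" for u v
      using that by (auto simp: children_def)
    show ?thesis
      using sch'(2)[of k] False ne by (auto simp: relaxed_step_def c'_def l'_def)
  qed
  have "blocked d h (2 * (p + 1)) (c' k)" for k
  proof (induction k)
    case 0
    have "0 < m"
      using sch'(3,7) root(1) by (cases m) (auto simp: zero_config_iff)
    then show ?case
      using sch'(3) by (intro blocked_zero) (simp add: c'_def)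
  next
    case (Suc k)
    show ?case
      by (rule blocked_step[OF assms(1) adm adm step Suc])
  qed
  from blocked_root[OF assms(1,2) this[of N]]
  have "(real d - 1) * real h + 2 \<le> 2 * (p + 1)"
    using sch'(4)[of N] sch'(6) inner_subset_tree
    by (force simp: c'_def zero_config_iff)
  then show ?thesis
    by simp
qed

section \<open>Sharp lower bounds for small heights\<close>

text \<open>
  Around the time at which the root is pebbled consider the longest interval in which no parent of
  leaves is pebbled. \<open>b\<close> are the black values at its beginning and \<open>w\<close> the white values at its end;
  \<open>z\<close> is the parent of leaves pebbled just before.
\<close>

definition window :: "nat \<Rightarrow> nat \<Rightarrow> real \<Rightarrow> (node \<Rightarrow> real) \<Rightarrow> (node \<Rightarrow> real) \<Rightarrow> node \<Rightarrow> bool" where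
  "window d h p b w z \<longleftrightarrow> (\<forall>v\<in>inner d h. 0 \<le> b v \<and> b v \<le> 1 \<and> 0 \<le> w v) \<and> length z + 2 = h \<and>
    sum b (inner d h - {z}) \<le> p - real d \<and> sum w (inner d h) \<le> p - real d \<and>
    (\<forall>k<d. hidden d h b w [k])"

text \<open>Suppose a node has value 1 at some time in the interval. If it is never pebbled there,
  its black value was at least as large at the beginning and its white value is at least as large at
  the end, so it is full. If it is pebbled, its children had value 1 at that time, and induction on
  the height applies. The interval contains no pebbling of a parent of leaves, so the induction
  stops at the latest at height 2.\<close>

lemma pebbling_window:
  assumes "1 \<le> d" "3 \<le> h" "has_pebbling (balanced_tree d h) p"
  shows "\<exists>b w z. window d h p b w z"
proof -
  let ?T = "balanced_tree d h"
  obtain N c l m where sch: "schedule ?T p N c l m"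
    using has_pebbling_schedule[OF assms(3)] by blast
  note sch' = scheduleD[OF sch]
  have root: "[] \<in> ?T" "[] \<in> inner d h"
    using assms(2) by (auto simp: balanced_tree_def inner_def)
  note inT = subsetD[OF inner_subset_tree]
  have valid: "0 \<le> fst (c k) v" "0 \<le> snd (c k) v" "fst (c k) v + snd (c k) v \<le> 1" if "v \<in> inner d h" for k v
    using sch'(1)[of k] that inner_subset_tree by (auto simp: admissible_def valid_config_iff)
  have mono: "fst (c j) v \<le> fst (c i) v \<and> snd (c i) v \<le> snd (c j) v"
    if "i \<le> j" "v \<in> ?T" "\<And>k. i \<le> k \<Longrightarrow> k < j \<Longrightarrow> l k \<noteq> Some v" for i j v
    using that(1,3)
  proof (induction rule: dec_induct)
    case (step n)
    then have "l n \<noteq> Some v"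
      by simp
    then show ?case
      using relaxed_stepD(1,2)[OF sch'(2)[of n] that(2)] step.IH step.prems by simp
  qed simp
  have "\<exists>t. l t = Some []"
  proof (rule ccontr)
    assume "\<nexists>t. l t = Some []"
    then have "fst (c m) [] \<le> fst (c 0) []"
      using mono[of 0 m "[]"] root(1) by auto
    then show False
      using sch'(3,7) root(1) by (auto simp: zero_config_iff)
  qed
  then obtain t where t: "l t = Some []" ..
  have "t < N"
    using sch'(5)[of t] t by (cases "t < N") auto
  have full_t: "fst (c t) [k] + snd (c t) [k] = 1" if "k < d" for k
    using relaxed_stepD(4)[OF sch'(2) t] children_inner[OF root(2)] that by auto
  have child: "[k] \<in> inner d h" if "k < d" for k
    using that assms(2) by (auto simp: inner_def)
  have p: "0 \<le> p - real d"
  proof -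
    have "real d = (\<Sum>x\<in>(\<lambda>k. [k]) ` {..<d}. fst (c t) x + snd (c t) x)"
      using full_t by (subst sum.reindex) (auto simp: inj_on_def)
    also have "\<dots> \<le> num_pebbles ?T (c t)"
      unfolding num_pebbles_eq using sch'(1)[of t] child inner_subset_tree
      by (intro sum_mono2) (auto simp: admissible_def valid_config_iff)
    also have "\<dots> \<le> p"
      using sch'(1)[of t] by (simp add: admissible_def)
    finally show ?thesis
      by simp
  qed
  define event where "event k \<longleftrightarrow> (\<exists>z. l k = Some z \<and> length z + 2 = h)" for k
  have "\<not> event t"
    using t assms(2) by (auto simp: event_def)
  have weight: "(\<Sum>x\<in>inner d h. fst (c k) x + snd (c k) x) \<le> p - real d" if ev: "event k" for k
  proof -
    obtain z where "l k = Some z" "length z + 2 = h"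
      using ev unfolding event_def by blast
    then show ?thesis
      using pebbled_weight[of d h p "c k" z "c (Suc k)"] sch'(1)[of k] sch'(2)[of k] by simp
  qed
  obtain s0 z where s0: "s0 \<le> t" "\<And>k. s0 \<le> k \<Longrightarrow> k < t \<Longrightarrow> \<not> event k" "length z + 2 = h"
    "sum (fst (c s0)) (inner d h - {z}) \<le> p - real d"
  proof (cases "\<exists>k<t. event k")
    case False
    \<comment> \<open>With no earlier event, any parent of leaves may serve as
      \<open>z\<close>.\<close>
    have "sum (fst (c 0)) (inner d h - {replicate (h - 2) 0}) = 0"
      using sch'(3) inner_subset_tree by (intro sum.neutral) (auto simp: zero_config_iff)
    then show thesis
      using False p assms(2) by (intro that[of 0 "replicate (h - 2) 0"]) auto
  next
    case True
    define e where "e = Max {k. k < t \<and> event k}"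
    have "e \<in> {k. k < t \<and> event k}"
      unfolding e_def using True by (intro Max_in) auto
    then have e: "e < t" "event e"
      by auto
    have e_max: "k \<le> e" if "k < t" "event k" for k
      unfolding e_def using that by (intro Max_ge) auto
    obtain z where z: "l e = Some z" "length z + 2 = h"
      using e(2) by (auto simp: event_def)
    \<comment> \<open>The interval begins just after the event, when \<open>z\<close> alone may have
      gained black; this is why \<open>z\<close> is exempt from the bound.\<close>
    have "sum (fst (c (Suc e))) (inner d h - {z}) \<le> (\<Sum>x\<in>inner d h - {z}. fst (c e) x + snd (c e) x)"
    proof (rule sum_mono)
      fix x assume "x \<in> inner d h - {z}"
      then show "fst (c (Suc e)) x \<le> fst (c e) x + snd (c e) x"
        using relaxed_stepD(1)[OF sch'(2)[of e], of x] z(1) valid(2)[of x e] inT[of x] by auto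
    qed
    also have "\<dots> \<le> (\<Sum>x\<in>inner d h. fst (c e) x + snd (c e) x)"
      using valid(1,2) by (intro sum_mono2) (auto simp: add_nonneg_nonneg)
    also have "\<dots> \<le> p - real d"
      by (rule weight[OF e(2)])
    finally have sum: "sum (fst (c (Suc e))) (inner d h - {z}) \<le> p - real d" .
    show thesis
    proof (rule that[OF _ _ z(2) sum])
      show "Suc e \<le> t"
        using e(1) by simp
      show "\<not> event k" if "Suc e \<le> k" "k < t" for k
        using e_max[OF that(2)] that(1) by fastforce
    qed
  qed
  obtain s1 where s1: "t \<le> s1" "\<And>k. t \<le> k \<Longrightarrow> k < s1 \<Longrightarrow> \<not> event k"
    "sum (snd (c s1)) (inner d h) \<le> p - real d"
  proof (cases "\<exists>k\<ge>t. event k")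
    case False
    have "sum (snd (c N)) (inner d h) = 0"
      using sch'(4)[of N] inner_subset_tree by (intro sum.neutral) (auto simp: zero_config_iff)
    then show thesis
      using False p \<open>t < N\<close> by (intro that[of N]) auto
  next
    case True
    define e where "e = (LEAST k. t \<le> k \<and> event k)"
    have e: "t \<le> e" "event e"
      using LeastI_ex[of "\<lambda>k. t \<le> k \<and> event k"] True by (auto simp: e_def)
    have "sum (snd (c e)) (inner d h) \<le> (\<Sum>x\<in>inner d h. fst (c e) x + snd (c e) x)"
      using valid by (intro sum_mono) auto
    also have "\<dots> \<le> p - real d"
      by (rule weight[OF e(2)])
    finally have sum: "sum (snd (c e)) (inner d h) \<le> p - real d" .
    show thesis
    proof (rule that[OF e(1) _ sum])
      show "\<not> event k" if "t \<le> k" "k < e" for k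
        using not_less_Least[of k "\<lambda>k. t \<le> k \<and> event k"] that by (simp add: e_def)
    qed
  qed
  have no_event: "\<not> event k" if "s0 \<le> k" "k < s1" for k
    using that s0(2) s1(2) by (cases "k < t") auto
  have hid: "hidden d h (fst (c s0)) (snd (c s1)) v"
    if "v \<in> inner d h" "s0 \<le> k" "k \<le> s1" "fst (c k) v + snd (c k) v = 1" for v k
    using that
  proof (induction "h - length v" arbitrary: v k rule: less_induct)
    case less
    show ?case
    proof (cases "\<exists>j. s0 \<le> j \<and> j < s1 \<and> l j = Some v")
      case True
      then obtain j where j: "s0 \<le> j" "j < s1" "l j = Some v"
        by blast
      then have "length v + 2 \<noteq> h"
        using no_event by (auto simp: event_def)
      then have len: "length v + 3 \<le> h"
        using less.prems(1) by (auto simp: inner_def)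
      show ?thesis
      proof (rule hidden.below[OF len])
        fix i assume i: "i < d"
        have "fst (c j) (v @ [i]) + snd (c j) (v @ [i]) = 1"
          using relaxed_stepD(4)[OF sch'(2) j(3)] children_inner[OF less.prems(1)] i by auto
        then show "hidden d h (fst (c s0)) (snd (c s1)) (v @ [i])"
          using less.hyps[of "v @ [i]" j] child_inner[OF less.prems(1) len i] len j by simp
      qed
    next
      case False
      have "v \<in> ?T"
        using less.prems(1) inner_subset_tree by blast
      then have "fst (c k) v \<le> fst (c s0) v" "snd (c k) v \<le> snd (c s1) v"
        using mono[of s0 k v] mono[of k s1 v] less.prems False by auto
      then show ?thesis
        using less.prems(4) by (intro hidden.full) simp
    qed
  qed
  have "0 \<le> fst (c s0) v \<and> fst (c s0) v \<le> 1 \<and> 0 \<le> snd (c s1) v" if "v \<in> inner d h" for v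
    using valid[OF that, of s0] valid[OF that, of s1] by auto
  moreover have "hidden d h (fst (c s0)) (snd (c s1)) [k]" if "k < d" for k
    using hid[OF child[OF that] s0(1) s1(1) full_t[OF that]] .
  ultimately have "window d h p (fst (c s0)) (snd (c s1)) z"
    using s0(3,4) s1(3) by (simp add: window_def)
  then show ?thesis
    by (intro exI)
qed

lemma window_arith: "a \<le> x + y \<Longrightarrow> x \<le> x' + e \<Longrightarrow> x' \<le> q \<Longrightarrow> y \<le> q \<Longrightarrow> a \<le> 2 * q + (e :: real)"
  by linarith

text \<open>Black and white values contribute at most \<open>p - d\<close> each, apart from the
  black value of \<open>z\<close>, which adds at most 1.\<close>

lemma window_count:
  assumes "window d h p b w z" "X \<subseteq> inner d h" "\<And>v. v \<in> X \<Longrightarrow> 1 \<le> b v + w v"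
  shows "real (card X) \<le> 2 * (p - real d) + (if z \<in> X then 1 else 0)"
proof -
  have fin: "finite X"
    by (rule finite_subset[OF assms(2) finite_inner])
  have val: "0 \<le> b v" "b v \<le> 1" "0 \<le> w v" if "v \<in> inner d h" for v
    using assms(1) that by (auto simp: window_def)
  have sums: "sum b (inner d h - {z}) \<le> p - real d" "sum w (inner d h) \<le> p - real d"
    using assms(1) by (auto simp: window_def)
  have "(\<Sum>v\<in>X. 1) \<le> (\<Sum>v\<in>X. b v + w v)"
    by (rule sum_mono) (rule assms(3))
  then have "real (card X) \<le> sum b X + sum w X"
    by (simp add: sum.distrib)
  moreover have "sum b X \<le> sum b (X - {z}) + (if z \<in> X then 1 else 0)"
  proof (cases "z \<in> X")
    case True
    then have "b z \<le> 1"
      using assms(2) val(2) by blast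
    then show ?thesis
      using True sum.remove[OF fin True, of b] by simp
  qed simp
  moreover have "sum b (X - {z}) \<le> sum b (inner d h - {z})" "sum w X \<le> sum w (inner d h)"
    using assms(2) val(1,3) by (auto intro!: sum_mono2)
  then have "sum b (X - {z}) \<le> p - real d" "sum w X \<le> p - real d"
    using sums by simp_all
  ultimately show ?thesis
    by (rule window_arith)
qed

text \<open>At height 3 the children of the root are parents of leaves and can be hidden only by
  being full. So \<open>d\<close> is at most \<open>2 * (p - d) + 1\<close>.\<close>

lemma pebbling_lower_bound_3:
  assumes "1 \<le> d" "has_pebbling (balanced_tree d 3) p"
  shows "3 / 2 * real d - 1 / 2 \<le> p"
proof -
  obtain b w z where win: "window d 3 p b w z"
    using pebbling_window[OF assms(1) order_refl assms(2)] by blast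
  have "1 \<le> b [k] + w [k]" if "k < d" for k
    using win that hidden_iff[of d 3 b w "[k]"] by (simp add: window_def hidden_below_def)
  then have "real (card ((\<lambda>k. [k]) ` {..<d})) \<le> 2 * (p - real d) + (if z \<in> (\<lambda>k. [k]) ` {..<d} then 1 else 0)"
    by (intro window_count[OF win]) (auto simp: inner_def)
  moreover have "card ((\<lambda>k. [k]) ` {..<d}) = d"
    by (simp add: card_image inj_on_def)
  ultimately show ?thesis
    by (simp split: if_splits)
qed

text \<open>If both children of the root are full, then \<open>z\<close>, which lies at depth 2, is
  not among them and \<open>2 <= 2 * (p - 2)\<close>. Otherwise there are at least three full nodes,
  and \<open>3 <= 2 * (p - 2) + 1\<close> holds even if \<open>z\<close> is one of them.\<close>

lemma pebbling_lower_bound_4: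
  assumes "has_pebbling (balanced_tree 2 4) p"
  shows "3 \<le> p"
proof -
  have "1 \<le> (2 :: nat)" "3 \<le> (4 :: nat)"
    by simp_all
  from pebbling_window[OF this assms] obtain b w z where win: "window 2 4 p b w z"
    by blast
  define full where "full v \<longleftrightarrow> 1 \<le> b v + w v" for v
  have hid: "full [k] \<or> full [k, 0] \<and> full [k, 1]" if "k < 2" for k
  proof -
    have "hidden 2 4 b w [k]"
      using win that by (simp add: window_def)
    then show ?thesis
      using hidden_iff[of 2 4 b w "[k]"] hidden_iff[of 2 4 b w "[k, 0]"] hidden_iff[of 2 4 b w "[k, 1]"]
      by (auto simp: hidden_below_def full_def)
  qed
  have z: "length z = 2"
    using win by (simp add: window_def)
  have count: "real (card X) \<le> 2 * (p - 2) + (if z \<in> X then 1 else 0)"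
    if "X \<subseteq> inner 2 4" "\<And>v. v \<in> X \<Longrightarrow> full v" for X
    using window_count[OF win that(1)] that(2) by (simp add: full_def)
  consider "full [0]" "full [1]" | "full [0]" "full [1, 0]" "full [1, 1]"
    | "full [1]" "full [0, 0]" "full [0, 1]" | "full [0, 0]" "full [0, 1]" "full [1, 0]" "full [1, 1]"
    using hid[of 0] hid[of 1] by auto
  then show ?thesis
  proof cases
    case 1
    then have "real (card {[0], [1 :: nat]}) \<le> 2 * (p - 2) + (if z \<in> {[0], [1]} then 1 else 0)"
      by (intro count) (auto simp: inner_def)
    then show ?thesis
      using z by (auto split: if_splits)
  next
    case 2
    then have "real (card {[0], [1, 0], [1, 1 :: nat]}) \<le> 2 * (p - 2) + (if z \<in> {[0], [1, 0], [1, 1]} then 1 else 0)"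
      by (intro count) (auto simp: inner_def)
    then show ?thesis
      by (simp split: if_splits)
  next
    case 3
    then have "real (card {[1], [0, 0], [0, 1 :: nat]}) \<le> 2 * (p - 2) + (if z \<in> {[1], [0, 0], [0, 1]} then 1 else 0)"
      by (intro count) (auto simp: inner_def)
    then show ?thesis
      by (simp split: if_splits)
  next
    case 4
    then have "real (card {[0, 0], [0, 1], [1, 0], [1, 1 :: nat]}) \<le>
        2 * (p - 2) + (if z \<in> {[0, 0], [0, 1], [1, 0], [1, 1]} then 1 else 0)"
      by (intro count) (auto simp: inner_def)
    then show ?thesis
      by (simp split: if_splits)
  qed
qed

theorem theorem4p4:
  "(\<forall>d h :: nat. d \<ge> 2 \<and> h \<ge> 2 \<longrightarrow>
      (real d - 1) * real h / 2 - real d / 2 \<le> FRpebbles (balanced_tree d h) \<and>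
      FRpebbles (balanced_tree d h) \<le> (real d - 1) * real h / 2 + 1) \<and>
   (\<forall>d :: nat. d \<ge> 2 \<longrightarrow> FRpebbles (balanced_tree d 3) = 3 / 2 * real d - 1 / 2) \<and>
   FRpebbles (balanced_tree 2 4) = 3"
proof -
  have peb: "has_pebbling (balanced_tree d h) (FRpebbles (balanced_tree d h))"
    and upper: "FRpebbles (balanced_tree d h) \<le> (real d - 1) * real h / 2 + 1"
    if "d \<ge> 2" "h \<ge> 2" for d h
  proof -
    have tree: "is_tree (balanced_tree d h)"
      using that(2) by (intro is_tree_balanced_tree) simp
    note peb = has_pebbling_balanced_tree[OF that]
    show "has_pebbling (balanced_tree d h) (FRpebbles (balanced_tree d h))"
      by (rule FRpebbles_minimum(1)[OF tree peb])
    show "FRpebbles (balanced_tree d h) \<le> (real d - 1) * real h / 2 + 1"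
      by (rule FRpebbles_minimum(2)[OF tree peb peb])
  qed
  have "(real d - 1) * real h / 2 - real d / 2 \<le> FRpebbles (balanced_tree d h)"
    if "d \<ge> 2" "h \<ge> 2" for d h
    \<comment> \<open>The weighting argument gives \<open>(d - 1) * h / 2\<close>, which exceeds the
      required bound by \<open>d / 2\<close>.\<close>
    using pebbling_lower_bound[OF _ that(2) peb[OF that]] that(1) by simp
  moreover have "FRpebbles (balanced_tree d 3) = 3 / 2 * real d - 1 / 2" if "d \<ge> 2" for d
  proof (rule antisym)
    show "FRpebbles (balanced_tree d 3) \<le> 3 / 2 * real d - 1 / 2"
      \<comment> \<open>At \<open>h = 3\<close> the general upper bound
        \<open>3 * (d - 1) / 2 + 1\<close> is already the exact value; likewise it equals 3 for
        \<open>d = 2\<close>, \<open>h = 4\<close>.\<close>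
      using upper[OF that, of 3] by (simp add: field_simps)
    show "3 / 2 * real d - 1 / 2 \<le> FRpebbles (balanced_tree d 3)"
      by (rule pebbling_lower_bound_3) (use that peb[OF that, of 3] in auto)
  qed
  moreover have "FRpebbles (balanced_tree 2 4) = 3"
    using pebbling_lower_bound_4[OF peb[of 2 4]] upper[of 2 4] by simp
  ultimately show ?thesis
    using upper by blast
qed

end
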